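(* If $S$ is an open subset of a spacetime $X$, then $S\subseteq I^+(S)$, $S\subseteq I^-(S)$, $I^+(S)=J^+(S)$ and $I^-(S)=J^-(S)$.
   Context: A spacetime is a Lorentzian manifold $X$ with a time orientation. For $s,t\in X$, write $s\ll t$ when there is a future-directed timelike curve from $s$ to $t$, and $s\prec t$ when there is a future-directed non-spacelike curve from $s$ to $t$ (with the convention that $t\prec t$ for all $t$). Put $I^+(t)=\{s\in X\mid t\ll s\}$, $I^-(t)=\{s\in X\mid s\ll t\}$, $J^+(t)=\{s\in X\mid t\prec s\}$, $J^-(t)=\{s\in X\mid s\prec t\}$. For $S\subseteq X$, put $I^\pm(S)=\bigcup_{s\in S}I^\pm(s)$ and $J^\pm(S)=\bigcup_{s\in S}J^\pm(s)$. *)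

theory Defs
  imports "HOL-Analysis.Analysis"
begin

section \<open>Smooth maps between open subsets of Euclidean spaces\<close>

text \<open>These notions are only meant for open \<^term>\<open>U\<close>.\<close>

primrec Ck_on :: "nat \<Rightarrow> 'a::real_normed_vector set \<Rightarrow> ('a \<Rightarrow> 'b::real_normed_vector) \<Rightarrow> bool" where
  "Ck_on 0 U f \<longleftrightarrow> continuous_on U f"
| "Ck_on (Suc k) U f \<longleftrightarrow>
     (\<forall>x\<in>U. f differentiable (at x)) \<and> (\<forall>v. Ck_on k U (\<lambda>x. frechet_derivative f (at x) v))"

definition smooth_on :: "'a::real_normed_vector set \<Rightarrow> ('a \<Rightarrow> 'b::real_normed_vector) \<Rightarrow> bool" where
  "smooth_on U f \<longleftrightarrow> (\<forall>k. Ck_on k U f)"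


section \<open>Smooth manifolds\<close>

text \<open>
  A chart is a pair of its domain and its coordinate map; only the values of the coordinate map on
  the domain matter. The manifold is the union of the chart domains of an atlas, an open subset of
  a Hausdorff, second countable space. The atlas need not be maximal.
\<close>

type_synonym ('a, 'e) chart = "'a set \<times> ('a \<Rightarrow> 'e)"

abbreviation dom_chart :: "('a, 'e) chart \<Rightarrow> 'a set" where
  "dom_chart c \<equiv> fst c"

abbreviation coord :: "('a, 'e) chart \<Rightarrow> 'a \<Rightarrow> 'e" where
  "coord c \<equiv> snd c"

definition inv_coord :: "('a, 'e) chart \<Rightarrow> 'e \<Rightarrow> 'a" where
  "inv_coord c = inv_into (dom_chart c) (coord c)"

definition is_chart :: "('a::topological_space, 'e::euclidean_space) chart \<Rightarrow> bool" where
  "is_chart c \<longleftrightarrow>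
     open (dom_chart c) \<and> open (coord c ` dom_chart c) \<and>
     homeomorphism (dom_chart c) (coord c ` dom_chart c) (coord c) (inv_coord c)"

abbreviation transition :: "('a, 'e) chart \<Rightarrow> ('a, 'e) chart \<Rightarrow> 'e \<Rightarrow> 'e" where
  "transition c d \<equiv> coord d \<circ> inv_coord c"

definition points :: "('a, 'e) chart set \<Rightarrow> 'a set" where
  "points A = (\<Union>c\<in>A. dom_chart c)"

definition smooth_manifold ::
  "('a::{t2_space,second_countable_topology}, 'e::euclidean_space) chart set \<Rightarrow> bool" where
  "smooth_manifold A \<longleftrightarrow>
     (\<forall>c\<in>A. is_chart c) \<and>
     (\<forall>c\<in>A. \<forall>d\<in>A. smooth_on (coord c ` (dom_chart c \<inter> dom_chart d)) (transition c d))"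


section \<open>Tangent vectors\<close>

text \<open>
  A tangent vector at \<^term>\<open>p\<close> assigns to every chart of the atlas around \<^term>\<open>p\<close> a component vector
  in the model space, such that the components in different charts are related by the derivative of
  the transition map. The value at all other charts is fixed to be 0. The vector space structure is
  pointwise.
\<close>

type_synonym ('a, 'e) tvec = "('a, 'e) chart \<Rightarrow> 'e"

definition tangent_space ::
  "('a, 'e::euclidean_space) chart set \<Rightarrow> 'a \<Rightarrow> ('a, 'e) tvec set" where
  "tangent_space A p = {v.
     (\<forall>c. \<not> (c \<in> A \<and> p \<in> dom_chart c) \<longrightarrow> v c = 0) \<and>
     (\<forall>c\<in>A. \<forall>d\<in>A. p \<in> dom_chart c \<inter> dom_chart d \<longrightarrow>
        v d = frechet_derivative (transition c d) (at (coord c p)) (v c))}"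

text \<open>The tangent vector at \<^term>\<open>p\<close> whose components in the chart \<^term>\<open>c\<close> are \<^term>\<open>x\<close>;
  for \<^term>\<open>x\<close> in \<^term>\<open>Basis\<close> these are the coordinate vectors of \<^term>\<open>c\<close>.\<close>

definition coord_vec ::
  "('a, 'e::euclidean_space) chart set \<Rightarrow> ('a, 'e) chart \<Rightarrow> 'a \<Rightarrow> 'e \<Rightarrow> ('a, 'e) tvec" where
  "coord_vec A c p x = (\<lambda>d. if d \<in> A \<and> p \<in> dom_chart d
     then frechet_derivative (transition c d) (at (coord c p)) x else 0)"


section \<open>Lorentzian metrics\<close>

type_synonym ('a, 'e) metric = "'a \<Rightarrow> ('a, 'e) tvec \<Rightarrow> ('a, 'e) tvec \<Rightarrow> real"

definition symmetric_bilinear_on ::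
  "('a, 'e::euclidean_space) tvec set \<Rightarrow> (('a, 'e) tvec \<Rightarrow> ('a, 'e) tvec \<Rightarrow> real) \<Rightarrow> bool" where
  "symmetric_bilinear_on T h \<longleftrightarrow>
     (\<forall>v\<in>T. \<forall>w\<in>T. h v w = h w v) \<and>
     (\<forall>u\<in>T. \<forall>v\<in>T. \<forall>w\<in>T. \<forall>r s.
        h (\<lambda>c. r *\<^sub>R u c + s *\<^sub>R v c) w = r * h u w + s * h v w)"

text \<open>
  Signature $(-,+,\dots,+)$: there is an orthonormal basis with exactly one vector of negative
  square. The basis is indexed by \<^term>\<open>Basis\<close> of the model space; its linear independence is a
  consequence of orthonormality.
\<close>

definition lorentzian_signature ::
  "('a, 'e::euclidean_space) tvec set \<Rightarrow> (('a, 'e) tvec \<Rightarrow> ('a, 'e) tvec \<Rightarrow> real) \<Rightarrow> bool" where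
  "lorentzian_signature T h \<longleftrightarrow>
     (\<exists>(b :: 'e \<Rightarrow> ('a, 'e) tvec) i0. i0 \<in> Basis \<and>
        (\<forall>i\<in>Basis. b i \<in> T) \<and>
        (\<forall>v\<in>T. \<exists>r. v = (\<lambda>c. \<Sum>i\<in>Basis. r i *\<^sub>R b i c)) \<and>
        (\<forall>i\<in>Basis. \<forall>j\<in>Basis.
           h (b i) (b j) = (if i \<noteq> j then 0 else if i = i0 then - 1 else 1)))"

definition lorentzian_metric ::
  "('a, 'e::euclidean_space) chart set \<Rightarrow> ('a, 'e) metric \<Rightarrow> bool" where
  "lorentzian_metric A g \<longleftrightarrow>
     (\<forall>p\<in>points A. symmetric_bilinear_on (tangent_space A p) (g p) \<and>
                   lorentzian_signature (tangent_space A p) (g p)) \<and>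
     (\<forall>c\<in>A. \<forall>i\<in>Basis. \<forall>j\<in>Basis. smooth_on (coord c ` dom_chart c)
        (\<lambda>x. g (inv_coord c x) (coord_vec A c (inv_coord c x) i) (coord_vec A c (inv_coord c x) j)))"


section \<open>Time orientations and spacetimes\<close>

definition timelike_at ::
  "('a, 'e::euclidean_space) chart set \<Rightarrow> ('a, 'e) metric \<Rightarrow> 'a \<Rightarrow> ('a, 'e) tvec \<Rightarrow> bool" where
  "timelike_at A g p v \<longleftrightarrow> v \<in> tangent_space A p \<and> g p v v < 0"

text \<open>The zero vector does not count as non-spacelike.\<close>

definition nonspacelike_at ::
  "('a, 'e::euclidean_space) chart set \<Rightarrow> ('a, 'e) metric \<Rightarrow> 'a \<Rightarrow> ('a, 'e) tvec \<Rightarrow> bool" where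
  "nonspacelike_at A g p v \<longleftrightarrow> v \<in> tangent_space A p \<and> v \<noteq> (\<lambda>_. 0) \<and> g p v v \<le> 0"

text \<open>The one of the two timecones at \<^term>\<open>p\<close> that contains the timelike vector \<^term>\<open>u\<close>.\<close>

definition timecone ::
  "('a, 'e::euclidean_space) chart set \<Rightarrow> ('a, 'e) metric \<Rightarrow> 'a \<Rightarrow> ('a, 'e) tvec \<Rightarrow> ('a, 'e) tvec set" where
  "timecone A g p u = {v. timelike_at A g p v \<and> g p u v < 0}"

definition continuous_vector_field_on ::
  "('a::topological_space, 'e::euclidean_space) chart set \<Rightarrow> 'a set \<Rightarrow> ('a \<Rightarrow> ('a, 'e) tvec) \<Rightarrow> bool" where
  "continuous_vector_field_on A W V \<longleftrightarrow>
     (\<forall>q\<in>W. V q \<in> tangent_space A q) \<and>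
     (\<forall>c\<in>A. continuous_on (W \<inter> dom_chart c) (\<lambda>q. V q c))"

text \<open>
  A time orientation selects one timecone, the future cone \<^term>\<open>F p\<close>, at every point \<^term>\<open>p\<close>, in
  such a way that locally there are continuous vector fields with values in the selected cones.
\<close>

definition time_orientation ::
  "('a::topological_space, 'e::euclidean_space) chart set \<Rightarrow> ('a, 'e) metric \<Rightarrow>
   ('a \<Rightarrow> ('a, 'e) tvec set) \<Rightarrow> bool" where
  "time_orientation A g F \<longleftrightarrow>
     (\<forall>p\<in>points A. \<exists>u. timelike_at A g p u \<and> F p = timecone A g p u) \<and>
     (\<forall>p\<in>points A. \<exists>W V. open W \<and> p \<in> W \<and> W \<subseteq> points A \<and>
        continuous_vector_field_on A W V \<and> (\<forall>q\<in>W. V q \<in> F q))"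

definition spacetime ::
  "('a::{t2_space,second_countable_topology}, 'e::euclidean_space) chart set \<Rightarrow> ('a, 'e) metric \<Rightarrow>
   ('a \<Rightarrow> ('a, 'e) tvec set) \<Rightarrow> bool" where
  "spacetime A g F \<longleftrightarrow> smooth_manifold A \<and> lorentzian_metric A g \<and> time_orientation A g F"

definition future_timelike ::
  "('a, 'e::euclidean_space) chart set \<Rightarrow> ('a, 'e) metric \<Rightarrow> ('a \<Rightarrow> ('a, 'e) tvec set) \<Rightarrow>
   'a \<Rightarrow> ('a, 'e) tvec set" where
  "future_timelike A g F p = {v. timelike_at A g p v \<and> v \<in> F p}"

text \<open>
  A non-spacelike vector is future-directed if it has negative product with the future-directed
  timelike vectors, i.e. if it is a non-zero element of the closure of the future cone.
\<close>

definition future_nonspacelike ::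
  "('a, 'e::euclidean_space) chart set \<Rightarrow> ('a, 'e) metric \<Rightarrow> ('a \<Rightarrow> ('a, 'e) tvec set) \<Rightarrow>
   'a \<Rightarrow> ('a, 'e) tvec set" where
  "future_nonspacelike A g F p = {v. nonspacelike_at A g p v \<and> (\<forall>u\<in>F p. g p u v < 0)}"


section \<open>Curves\<close>

text \<open>
  At the endpoints of the parameter interval all derivatives are one-sided. The filter
  \<^term>\<open>at t within {a..b}\<close> may be used although the coordinate expression of the curve is only
  meaningful where the curve is in the chart domain: by continuity this is the case near \<^term>\<open>t\<close>.
\<close>

definition C1_curve_on ::
  "('a::topological_space, 'e::euclidean_space) chart set \<Rightarrow> real \<Rightarrow> real \<Rightarrow> (real \<Rightarrow> 'a) \<Rightarrow> bool" where
  "C1_curve_on A a b \<gamma> \<longleftrightarrow>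
     continuous_on {a..b} \<gamma> \<and> \<gamma> ` {a..b} \<subseteq> points A \<and>
     (\<forall>c\<in>A. \<exists>D.
        (\<forall>t\<in>{a..b}. \<gamma> t \<in> dom_chart c \<longrightarrow>
           ((coord c \<circ> \<gamma>) has_vector_derivative D t) (at t within {a..b})) \<and>
        continuous_on {t\<in>{a..b}. \<gamma> t \<in> dom_chart c} D)"

definition velocity ::
  "('a, 'e::euclidean_space) chart set \<Rightarrow> real \<Rightarrow> real \<Rightarrow> (real \<Rightarrow> 'a) \<Rightarrow> real \<Rightarrow> ('a, 'e) tvec" where
  "velocity A a b \<gamma> t = (\<lambda>c. if c \<in> A \<and> \<gamma> t \<in> dom_chart c
     then vector_derivative (coord c \<circ> \<gamma>) (at t within {a..b}) else 0)"

text \<open>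
  Piecewise continuously differentiable curves whose velocity is everywhere in the set \<^term>\<open>K p\<close> of
  admissible tangent vectors; at each of the finitely many break points in \<^term>\<open>P\<close> this
  applies to both one-sided velocities.
\<close>

definition piecewise_C1_curve_in ::
  "('a::topological_space, 'e::euclidean_space) chart set \<Rightarrow> ('a \<Rightarrow> ('a, 'e) tvec set) \<Rightarrow>
   real \<Rightarrow> real \<Rightarrow> (real \<Rightarrow> 'a) \<Rightarrow> bool" where
  "piecewise_C1_curve_in A K a b \<gamma> \<longleftrightarrow> a < b \<and>
     (\<exists>P. finite P \<and>
        (\<forall>u v. a \<le> u \<and> u < v \<and> v \<le> b \<and> {u<..<v} \<inter> P = {} \<longrightarrow>
           C1_curve_on A u v \<gamma> \<and> (\<forall>t\<in>{u..v}. velocity A u v \<gamma> t \<in> K (\<gamma> t))))"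


section \<open>Causal relations\<close>

context
  fixes A :: "('a::{t2_space,second_countable_topology}, 'e::euclidean_space) chart set"
    and g :: "('a, 'e) metric"
    and F :: "'a \<Rightarrow> ('a, 'e) tvec set"
begin

definition chron_precedes :: "'a \<Rightarrow> 'a \<Rightarrow> bool" where
  "chron_precedes s t \<longleftrightarrow>
     (\<exists>\<gamma> a b. piecewise_C1_curve_in A (future_timelike A g F) a b \<gamma> \<and> \<gamma> a = s \<and> \<gamma> b = t)"

definition causal_precedes :: "'a \<Rightarrow> 'a \<Rightarrow> bool" where
  "causal_precedes s t \<longleftrightarrow> s = t \<or>
     (\<exists>\<gamma> a b. piecewise_C1_curve_in A (future_nonspacelike A g F) a b \<gamma> \<and> \<gamma> a = s \<and> \<gamma> b = t)"

definition I_plus_pt :: "'a \<Rightarrow> 'a set" where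
  "I_plus_pt t = {s\<in>points A. chron_precedes t s}"

definition I_minus_pt :: "'a \<Rightarrow> 'a set" where
  "I_minus_pt t = {s\<in>points A. chron_precedes s t}"

definition J_plus_pt :: "'a \<Rightarrow> 'a set" where
  "J_plus_pt t = {s\<in>points A. causal_precedes t s}"

definition J_minus_pt :: "'a \<Rightarrow> 'a set" where
  "J_minus_pt t = {s\<in>points A. causal_precedes s t}"

definition I_plus :: "'a set \<Rightarrow> 'a set" where
  "I_plus S = (\<Union>s\<in>S. I_plus_pt s)"

definition I_minus :: "'a set \<Rightarrow> 'a set" where
  "I_minus S = (\<Union>s\<in>S. I_minus_pt s)"

definition J_plus :: "'a set \<Rightarrow> 'a set" where
  "J_plus S = (\<Union>s\<in>S. J_plus_pt s)"

definition J_minus :: "'a set \<Rightarrow> 'a set" where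
  "J_minus S = (\<Union>s\<in>S. J_minus_pt s)"

end

end

theory Submission
  imports Defs
begin

text \<open>
  The inclusion of \<^term>\<open>S\<close> in its own chronological future is elementary: near a point of \<^term>\<open>S\<close> there is
  a vector with constant coordinates that is future timelike at all nearby points, and a short
  straight segment in its direction that ends at the point starts in \<^term>\<open>S\<close>
  (\<open>constant_future_vector\<close>, \<open>open_subset_I_plus\<close>).

  The substance is that a causal curve from \<^term>\<open>S\<close> to a point can be replaced by a timelike one if the
  starting point may be moved within the open set \<^term>\<open>S\<close>. The replacement is a direct perturbation
  within a chart. If \<open>x\<close> is a causal curve in coordinates and \<open>w\<close> a constant future timelike
  vector, then adding a positive multiple of \<open>w\<close> to the velocity of \<open>x\<close> makes it timelike. This
  moves the curve, and at the new base point the metric differs from the old one by an amount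
  that is linear in the displacement. An exponentially growing displacement along \<open>w\<close> has a
  derivative that dominates this error, and it may be fixed to be any given small vector at the
  end of the curve (\<open>negative_curves_to_nearby_points\<close>).

  It follows that the interior of a set that is closed under passing to the chronological future
  cannot be left along a causal curve: the perturbation reaches all points near the end of a short
  piece from points near its beginning (\<open>interior_future_set_local\<close>). A compactness argument
  extends this from short pieces within one chart to whole curves (\<open>piecewise_C1_curve_induct\<close>).
  Applied to the chronological future of \<^term>\<open>S\<close>, whose interior contains \<^term>\<open>S\<close>, it shows that this set
  contains the causal future. The converse inclusion holds because timelike curves are causal.

  The cones of future vectors enter through one algebraic fact: for timelike vectors, having
  negative product is a transitive relation (\<open>lorentzian_timelike_trans\<close>). The statements about pasts are the
  statements about futures for the reversed time orientation (\<open>past_eq_reverse_future\<close>).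
\<close>

section \<open>Smooth functions on Euclidean space\<close>

lemma smooth_on_imp_C1:
  assumes "smooth_on U f"
  shows "x \<in> U \<Longrightarrow> f differentiable (at x)"
    and "continuous_on U (\<lambda>x. frechet_derivative f (at x) v)"
proof -
  have "Ck_on (Suc 0) U f" using assms by (simp add: smooth_on_def)
  then show "x \<in> U \<Longrightarrow> f differentiable (at x)"
    and "continuous_on U (\<lambda>x. frechet_derivative f (at x) v)" by simp_all
qed

lemma linear_eq_sum_Basis:
  fixes f :: "'e::euclidean_space \<Rightarrow> 'b::real_vector"
  assumes "linear f"
  shows "f a = (\<Sum>i\<in>Basis. (a \<bullet> i) *\<^sub>R f i)"
proof -
  have "f a = f (\<Sum>i\<in>Basis. (a \<bullet> i) *\<^sub>R i)" by (simp add: euclidean_representation)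
  also have "\<dots> = (\<Sum>i\<in>Basis. (a \<bullet> i) *\<^sub>R f i)"
    using assms by (simp add: linear_sum linear_cmul)
  finally show ?thesis .
qed

lemma bilinear_eq_sum_Basis:
  fixes f :: "'e::euclidean_space \<Rightarrow> 'e \<Rightarrow> real"
  assumes "bilinear f"
  shows "f a b = (\<Sum>i\<in>Basis. \<Sum>j\<in>Basis. (a \<bullet> i) * (b \<bullet> j) * f i j)"
proof -
  have l: "linear (\<lambda>a. f a b)" "linear (f a)" for a b
    using assms by (simp_all add: bilinear_def)
  have "f a b = (\<Sum>i\<in>Basis. (a \<bullet> i) * f i b)"
    using linear_eq_sum_Basis[OF l(1), of a b] by simp
  also have "\<dots> = (\<Sum>i\<in>Basis. (a \<bullet> i) * (\<Sum>j\<in>Basis. (b \<bullet> j) * f i j))"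
    by (subst linear_eq_sum_Basis[OF l(2), of _ b]) simp
  finally show ?thesis by (simp add: sum_distrib_left mult.assoc)
qed

text \<open>
  Smoothness gives continuity of the derivative in the base point for each fixed direction.
  Joint continuity in base point and direction follows because a linear map on a Euclidean space
  is determined by the finitely many basis directions. It is what makes a $C^1$ curve in one chart
  $C^1$ in every other chart.
\<close>

lemma continuous_on_smooth_derivative:
  fixes f :: "'e::euclidean_space \<Rightarrow> 'b::real_normed_vector"
  assumes f: "smooth_on U f"
    and X: "continuous_on T X" "X ` T \<subseteq> U" and D: "continuous_on T D"
  shows "continuous_on T (\<lambda>t. frechet_derivative f (at (X t)) (D t))"
proof -
  have "continuous_on T (\<lambda>t. frechet_derivative f (at (X t)) i)" for i
    using continuous_on_compose2[OF smooth_on_imp_C1(2)[OF f] X] .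
  then have "continuous_on T (\<lambda>t. \<Sum>i\<in>Basis. (D t \<bullet> i) *\<^sub>R frechet_derivative f (at (X t)) i)"
    using D by (intro continuous_intros)
  moreover have "frechet_derivative f (at (X t)) (D t)
      = (\<Sum>i\<in>Basis. (D t \<bullet> i) *\<^sub>R frechet_derivative f (at (X t)) i)" if "t \<in> T" for t
    using that X(2) smooth_on_imp_C1(1)[OF f]
    by (intro linear_eq_sum_Basis linear_frechet_derivative) auto
  ultimately show ?thesis by (simp cong: continuous_on_cong)
qed

text \<open>
  The partial derivatives are bounded on a compact ball, so the mean value inequality applies.
  Through this lemma the smoothness of a metric enters the perturbation argument below.
\<close>

lemma smooth_on_lipschitz_cball:
  fixes f :: "'e::euclidean_space \<Rightarrow> real"
  assumes f: "smooth_on U f" and U: "cball x0 r \<subseteq> U"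
  shows "\<exists>L\<ge>0. \<forall>x\<in>cball x0 r. \<forall>y\<in>cball x0 r. \<bar>f x - f y\<bar> \<le> L * norm (x - y)"
proof -
  let ?D = "\<lambda>x. frechet_derivative f (at x)"
  have "\<exists>C. \<forall>x\<in>cball x0 r. \<bar>?D x i\<bar> \<le> C" for i
  proof -
    have "continuous_on (cball x0 r) (\<lambda>x. ?D x i)"
      using smooth_on_imp_C1(2)[OF f] U continuous_on_subset by blast
    then have "bounded ((\<lambda>x. ?D x i) ` cball x0 r)"
      by (simp add: compact_continuous_image compact_imp_bounded)
    then show ?thesis by (simp add: bounded_iff)
  qed
  then obtain C where C: "\<And>i x. x \<in> cball x0 r \<Longrightarrow> \<bar>?D x i\<bar> \<le> C i" by metis
  let ?L = "\<Sum>i\<in>Basis. \<bar>C i\<bar>"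
  have "\<bar>f x - f y\<bar> \<le> ?L * norm (x - y)" if "x \<in> cball x0 r" "y \<in> cball x0 r" for x y
  proof -
    have "norm (f x - f y) \<le> ?L * norm (x - y)"
    proof (rule differentiable_bound[where f' = ?D and S = "cball x0 r"])
      fix z assume z: "z \<in> cball x0 r"
      then have d: "f differentiable (at z)" using smooth_on_imp_C1(1)[OF f] U by blast
      then show "(f has_derivative ?D z) (at z within cball x0 r)"
        using frechet_derivative_works has_derivative_at_withinI by blast
      show "onorm (?D z) \<le> ?L"
      proof (rule onorm_le)
        fix a
        have "norm (?D z a) = \<bar>\<Sum>i\<in>Basis. (a \<bullet> i) * ?D z i\<bar>"
          using linear_eq_sum_Basis[OF linear_frechet_derivative[OF d], of a] by simp
        also have "\<dots> \<le> (\<Sum>i\<in>Basis. \<bar>(a \<bullet> i) * ?D z i\<bar>)" by (rule sum_abs)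
        also have "\<dots> \<le> (\<Sum>i\<in>Basis. norm a * \<bar>C i\<bar>)"
        proof (rule sum_mono)
          fix i :: 'e assume "i \<in> Basis"
          then show "\<bar>(a \<bullet> i) * ?D z i\<bar> \<le> norm a * \<bar>C i\<bar>"
            using C[OF z, of i] Basis_le_norm[of i a] by (auto simp: abs_mult intro!: mult_mono)
        qed
        finally show "norm (?D z a) \<le> ?L * norm a"
          by (simp add: sum_distrib_left mult.commute)
      qed
    qed (use that in auto)
    then show ?thesis by simp
  qed
  then show ?thesis by (intro exI[of _ ?L] conjI ballI) (simp_all add: sum_nonneg)
qed

section \<open>Perturbing curves in a Lipschitz field of bilinear forms\<close>

text \<open>
  The model is the coordinate expression of a metric on a small open part of a chart. In the
  lemmas, \<^term>\<open>w\<close> plays the role of a vector that is future timelike at every point of \<^term>\<open>B\<close>, and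
  a velocity is future timelike if its square and its product with \<^term>\<open>w\<close> are both negative.
\<close>

locale lipschitz_forms =
  fixes B :: "'e::euclidean_space set" and G :: "'e \<Rightarrow> 'e \<Rightarrow> 'e \<Rightarrow> real" and L :: real
  assumes open_B: "open B"
    and bilinear: "y \<in> B \<Longrightarrow> bilinear (G y)"
    and sym: "y \<in> B \<Longrightarrow> G y a b = G y b a"
    and lipschitz: "y \<in> B \<Longrightarrow> z \<in> B \<Longrightarrow> \<bar>G y a b - G z a b\<bar> \<le> L * norm (y - z) * norm a * norm b"
    and L_nonneg: "L \<ge> 0"
begin

lemmas form_eq_sum_Basis = bilinear_eq_sum_Basis[OF bilinear]

lemma continuous_on_form:
  assumes X: "continuous_on T X" "X ` T \<subseteq> B" and "continuous_on T a" "continuous_on T b"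
  shows "continuous_on T (\<lambda>t. G (X t) (a t) (b t))"
proof -
  have "continuous_on B (\<lambda>y. G y i j)" for i j
  proof -
    have "L-lipschitz_on B (\<lambda>y. G y i j)" if "norm i = 1" "norm j = 1" for i j
      using lipschitz[of _ _ i j] L_nonneg that
      by (intro lipschitz_onI) (auto simp: dist_norm)
    then have *: "continuous_on B (\<lambda>y. G y i j)" if "i \<in> Basis" "j \<in> Basis" for i j
      using that lipschitz_on_continuous_on by (metis norm_Basis)
    have "continuous_on B (\<lambda>y. \<Sum>k\<in>Basis. \<Sum>l\<in>Basis. (i \<bullet> k) * (j \<bullet> l) * G y k l)"
      by (intro continuous_intros *)
    then show ?thesis
      by (rule continuous_on_eq) (rule form_eq_sum_Basis[symmetric])
  qed
  then have "continuous_on T (\<lambda>t. G (X t) i j)" for i j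
    using X by (rule continuous_on_compose2)
  then have "continuous_on T (\<lambda>t. \<Sum>i\<in>Basis. \<Sum>j\<in>Basis. (a t \<bullet> i) * (b t \<bullet> j) * G (X t) i j)"
    using assms by (intro continuous_intros)
  moreover have "G (X t) (a t) (b t) = (\<Sum>i\<in>Basis. \<Sum>j\<in>Basis. (a t \<bullet> i) * (b t \<bullet> j) * G (X t) i j)"
    if "t \<in> T" for t using that X(2) by (intro form_eq_sum_Basis) auto
  ultimately show ?thesis by (simp cong: continuous_on_cong)
qed

text \<open>
  Moving a causal vector \<^term>\<open>a\<close> from \<^term>\<open>x\<close> to a point \<^term>\<open>y\<close> at distance at most \<^term>\<open>r\<close> can make it
  spacelike, but only by an amount linear in \<^term>\<open>r\<close>. Adding \<^term>\<open>s *\<^sub>R w\<close> decreases the square by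
  more than \<^term>\<open>s * m\<close>, because the product of \<^term>\<open>a\<close> and \<^term>\<open>w\<close> is at most \<^term>\<open>- m\<close> at \<^term>\<open>x\<close> and
  therefore at most \<^term>\<open>- m / 2\<close> at \<^term>\<open>y\<close>. So it is enough that \<^term>\<open>s\<close> is large in comparison with
  \<^term>\<open>r\<close>.
\<close>

lemma perturbed_vector_negative:
  assumes x: "x \<in> B" and y: "y \<in> B" and w: "G y w w < 0"
    and a: "G x a a \<le> 0" "G x w a \<le> - m" "norm a \<le> M"
    and m: "m > 0" and r: "norm (y - x) \<le> r"
    and near: "L * r * norm w * M \<le> m / 2" and s: "L * r * M\<^sup>2 < s * m"
  shows "G y (a + s *\<^sub>R w) (a + s *\<^sub>R w) < 0" and "G y w (a + s *\<^sub>R w) < 0"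
proof -
  have r0: "r \<ge> 0" "M \<ge> 0" using r a(3) order_trans[OF norm_ge_zero] by auto
  have s0: "s > 0"
  proof -
    have "0 \<le> L * r * M\<^sup>2" using r0 L_nonneg by simp
    then show ?thesis using s m by (metis le_less_trans zero_less_mult_pos2)
  qed
  have lin: "linear (\<lambda>a. G y a b)" "linear (G y a)" for a b
    using bilinear[OF y] by (simp_all add: bilinear_def)
  have "G y a a \<le> G x a a + L * norm (y - x) * norm a * norm a"
    using lipschitz[OF y x, of a a] by linarith
  also have "\<dots> \<le> 0 + L * r * M * M"
    using a r r0 L_nonneg by (intro add_mono mult_mono) auto
  finally have aa: "G y a a \<le> L * r * M\<^sup>2" by (simp add: power2_eq_square mult.assoc)
  have "G y w a \<le> G x w a + L * norm (y - x) * norm w * norm a"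
    using lipschitz[OF y x, of w a] by linarith
  also have "\<dots> \<le> - m + L * r * norm w * M"
    using a r r0 L_nonneg by (intro add_mono mult_mono) auto
  finally have wa: "G y w a \<le> - m / 2" using near by linarith
  have swa: "s * G y w a \<le> - (s * m) / 2" using mult_left_mono[OF wa, of s] s0 by simp
  have sww: "s * G y w w < 0" using w s0 by (simp add: mult_pos_neg)
  have "G y (a + s *\<^sub>R w) (a + s *\<^sub>R w) = G y a a + 2 * (s * G y w a) + s * (s * G y w w)"
    using sym[OF y, of a w]
    by (simp add: linear_add[OF lin(1)] linear_add[OF lin(2)] linear_cmul[OF lin(1)]
        linear_cmul[OF lin(2)] algebra_simps)
  moreover have "s * (s * G y w w) < 0" using sww s0 by (simp add: mult_pos_neg)
  ultimately show "G y (a + s *\<^sub>R w) (a + s *\<^sub>R w) < 0" using aa swa s by linarith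
  have "G y w (a + s *\<^sub>R w) = G y w a + s * G y w w"
    by (simp add: linear_add[OF lin(2)] linear_cmul[OF lin(2)])
  then show "G y w (a + s *\<^sub>R w) < 0" using wa sww m by linarith
qed

text \<open>
  A causal curve \<^term>\<open>x\<close> is turned into a timelike curve that ends at a prescribed point \<^term>\<open>z\<close> near
  \<^term>\<open>x v\<close>, at the price of a small change of the starting point. The new curve is
  $y(t) = x(t) + (z - x(v)) - f(t) w$ with $f(v) = 0$. Its velocity is $x'(t) - f'(t) w$, and its
  distance from \<^term>\<open>x\<close> is at most $|z - x(v)| + f(t) |w|$. By the previous lemma \<^term>\<open>y\<close> is timelike as
  soon as $- f'$ exceeds a fixed multiple of that distance. This is a differential inequality, and
  $f(t) = \delta (e^{K (v - t)} - 1)$ with $|z - x(v)| < \delta$ satisfies it for large $K$. The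
  choice of \<^term>\<open>K\<close> does not depend on $\delta$, so for small $\delta$ the curve \<^term>\<open>y\<close> is as close to \<^term>\<open>x\<close> as desired.
\<close>

proposition negative_curves_to_nearby_points:
  assumes uv: "u < v"
    and w: "\<And>y. y \<in> B \<Longrightarrow> G y w w < 0"
    and xB: "x ` {u..v} \<subseteq> B"
    and x': "\<And>t. t \<in> {u..v} \<Longrightarrow> (x has_vector_derivative x' t) (at t within {u..v})"
    and cont: "continuous_on {u..v} x'"
    and nonpos: "\<And>t. t \<in> {u..v} \<Longrightarrow> G (x t) (x' t) (x' t) \<le> 0"
    and neg: "\<And>t. t \<in> {u..v} \<Longrightarrow> G (x t) w (x' t) < 0"
    and e: "e > 0"
  shows "\<exists>\<delta>>0. \<forall>z. dist z (x v) < \<delta> \<longrightarrow> (\<exists>y y'. y ` {u..v} \<subseteq> B \<and>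
       (\<forall>t\<in>{u..v}. (y has_vector_derivative y' t) (at t within {u..v}) \<and>
          G (y t) (y' t) (y' t) < 0 \<and> G (y t) w (y' t) < 0) \<and>
       continuous_on {u..v} y' \<and> dist (y u) (x u) < e \<and> y v = z)"
proof -
  have contx: "continuous_on {u..v} x"
    using x' has_vector_derivative_continuous continuous_on_eq_continuous_within by blast
  obtain M where M: "\<And>t. t \<in> {u..v} \<Longrightarrow> norm (x' t) \<le> M"
  proof -
    have "bounded (x' ` {u..v})"
      using cont by (simp add: compact_continuous_image compact_imp_bounded)
    then obtain M where "\<forall>t\<in>{u..v}. norm (x' t) \<le> M" by (auto simp: bounded_iff)
    then show ?thesis using that by blast
  qed
  obtain m where m: "m > 0" "\<And>t. t \<in> {u..v} \<Longrightarrow> G (x t) w (x' t) \<le> - m"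
  proof -
    have "continuous_on {u..v} (\<lambda>t. G (x t) w (x' t))"
      by (intro continuous_on_form contx xB cont continuous_intros)
    then obtain t0 where "t0 \<in> {u..v}" "\<forall>t\<in>{u..v}. G (x t) w (x' t) \<le> G (x t0) w (x' t0)"
      using continuous_attains_sup[of "{u..v}" "\<lambda>t. G (x t) w (x' t)"] uv by auto
    then show ?thesis using that[of "- G (x t0) w (x' t0)"] neg by auto
  qed
  obtain e1 where e1: "e1 > 0" "\<And>t. t \<in> {u..v} \<Longrightarrow> ball (x t) e1 \<subseteq> B"
  proof -
    have "compact (x ` {u..v})" using contx by (simp add: compact_continuous_image)
    then obtain e1 where "e1 > 0" "(\<Union>p\<in>x ` {u..v}. ball p e1) \<subseteq> B"
      using compact_subset_open_imp_ball_epsilon_subset open_B xB by blast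
    then have "ball (x t) e1 \<subseteq> B" if "t \<in> {u..v}" for t using that by blast
    then show ?thesis using that \<open>e1 > 0\<close> by blast
  qed
  \<comment> \<open>This is the constant of the differential inequality; the summand 1 makes the inequality strict
    and \<^term>\<open>K\<close> positive.\<close>
  define K where "K = L * (1 + norm w) * M\<^sup>2 / m + 1"
  have K1: "K \<ge> 1" using L_nonneg m by (simp add: K_def)
  have K: "L * (1 + norm w) * M\<^sup>2 < K * m" using m by (simp add: K_def field_simps)
  \<comment> \<open>The new curve deviates from \<^term>\<open>x\<close> by at most \<^term>\<open>\<delta> * C\<close>.\<close>
  define C where "C = (1 + norm w) * exp (K * (v - u))"
  have C: "C > 0" unfolding C_def by (simp add: add_pos_nonneg)
  have M0: "M \<ge> 0" using order_trans[OF norm_ge_zero M[of u]] uv by simp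
  \<comment> \<open>The bound \<^term>\<open>m / (2 * Q)\<close> on the deviation keeps the product of \<^term>\<open>w\<close> and the velocity of \<^term>\<open>x\<close>
    below \<^term>\<open>- m / 2\<close>; the summand 1 avoids a division by 0.\<close>
  define Q where "Q = L * norm w * M + 1"
  have Q: "Q \<ge> 1" using L_nonneg M0 by (simp add: Q_def)
  define \<mu> where "\<mu> = min (min e e1) (m / (2 * Q))"
  have \<mu>: "\<mu> > 0" "\<mu> \<le> e" "\<mu> \<le> e1" "\<mu> \<le> m / (2 * Q)"
    using e e1 m Q by (simp_all add: \<mu>_def)
  define \<delta> where "\<delta> = \<mu> / (2 * C)"
  have \<delta>0: "\<delta> > 0" using \<mu> C by (simp add: \<delta>_def)
  have "\<delta> * C = \<mu> / 2" using C by (simp add: \<delta>_def)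
  then have \<delta>C: "\<delta> * C < e" "\<delta> * C < e1" "\<delta> * C \<le> m / (2 * Q)" using \<mu> by linarith+
  show ?thesis
  proof (intro exI[of _ \<delta>] conjI allI impI \<delta>0)
    fix z assume z: "dist z (x v) < \<delta>"
    define E where "E t = exp (K * (v - t))" for t
    define y where "y t = x t + (z - x v) - (\<delta> * (E t - 1)) *\<^sub>R w" for t
    define y' where "y' t = x' t + (\<delta> * K * E t) *\<^sub>R w" for t
    have E1: "E t \<ge> 1" if "t \<in> {u..v}" for t using that K1 by (simp add: E_def)
    have r: "norm (y t - x t) \<le> \<delta> * (1 + norm w) * E t" if "t \<in> {u..v}" for t
    proof -
      have "norm (y t - x t) = norm ((z - x v) - (\<delta> * (E t - 1)) *\<^sub>R w)"
        by (simp add: y_def)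
      also have "\<dots> \<le> norm (z - x v) + norm ((\<delta> * (E t - 1)) *\<^sub>R w)"
        by (rule norm_triangle_ineq4)
      also have "norm ((\<delta> * (E t - 1)) *\<^sub>R w) = \<delta> * (E t - 1) * norm w"
        using \<delta>0 E1[OF that] by simp
      also have "norm (z - x v) + \<delta> * (E t - 1) * norm w \<le> \<delta> * E t + \<delta> * E t * norm w"
      proof (intro add_mono mult_right_mono)
        have "norm (z - x v) \<le> \<delta> * 1" using z by (simp add: dist_norm)
        also have "\<dots> \<le> \<delta> * E t" using \<delta>0 E1[OF that] by (intro mult_left_mono) auto
        finally show "norm (z - x v) \<le> \<delta> * E t" .
      qed (use \<delta>0 in auto)
      finally show ?thesis by (simp add: algebra_simps)
    qed
    have rC: "\<delta> * (1 + norm w) * E t \<le> \<delta> * C" if "t \<in> {u..v}" for t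
    proof -
      have "E t \<le> exp (K * (v - u))" using that K1 by (simp add: E_def)
      then show ?thesis unfolding C_def mult.assoc using \<delta>0 by (intro mult_left_mono) auto
    qed
    have yB: "y t \<in> B" if "t \<in> {u..v}" for t
    proof -
      have "dist (x t) (y t) < e1"
        using r[OF that] rC[OF that] \<delta>C by (simp add: dist_norm norm_minus_commute)
      then show ?thesis using e1(2)[OF that] by auto
    qed
    have "(y has_vector_derivative y' t) (at t within {u..v})" if "t \<in> {u..v}" for t
    proof -
      have E': "(E has_field_derivative - (K * E t)) (at t within {u..v})"
        unfolding E_def by (auto intro!: derivative_eq_intros)
      show ?thesis unfolding y_def y'_def
        by (auto intro!: derivative_eq_intros x' E' that)
    qed
    moreover have "G (y t) (y' t) (y' t) < 0 \<and> G (y t) w (y' t) < 0" if t: "t \<in> {u..v}" for t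
    proof -
      let ?r = "\<delta> * (1 + norm w) * E t"
      have "L * norm w * M * ?r \<le> Q * (\<delta> * C)"
        using L_nonneg M0 \<delta>0 E1[OF t] by (intro mult_mono[OF _ rC[OF t]]) (auto simp: Q_def)
      also have "\<dots> \<le> Q * (m / (2 * Q))" using \<delta>C Q by (intro mult_left_mono) auto
      also have "\<dots> = m / 2" using Q by simp
      finally have near: "L * ?r * norm w * M \<le> m / 2" by (simp add: mult_ac)
      have "L * (1 + norm w) * M\<^sup>2 * (\<delta> * E t) < K * m * (\<delta> * E t)"
        using K \<delta>0 E1[OF t] by (intro mult_strict_right_mono) auto
      then have *: "L * ?r * M\<^sup>2 < \<delta> * K * E t * m" by (simp add: mult_ac)
      have "x t \<in> B" using xB t by blast
      note perturbed = perturbed_vector_negative[OF this yB[OF t] w[OF yB[OF t]] nonpos[OF t]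
          m(2)[OF t] M[OF t] m(1) r[OF t] near *]
      show ?thesis unfolding y'_def using perturbed by simp
    qed
    moreover have "continuous_on {u..v} y'"
      unfolding y'_def E_def by (intro continuous_intros cont)
    moreover have "dist (y u) (x u) < e"
      using r[of u] rC[of u] \<delta>C uv by (simp add: dist_norm)
    moreover have "y v = z" by (simp add: y_def E_def)
    ultimately show "\<exists>y y'. y ` {u..v} \<subseteq> B \<and>
       (\<forall>t\<in>{u..v}. (y has_vector_derivative y' t) (at t within {u..v}) \<and>
          G (y t) (y' t) (y' t) < 0 \<and> G (y t) w (y' t) < 0) \<and>
       continuous_on {u..v} y' \<and> dist (y u) (x u) < e \<and> y v = z"
      using yB by (intro exI[of _ y] exI[of _ y']) auto
  qed
qed

end

section \<open>Timelike vectors of a Lorentzian form\<close>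

lemma symmetric_bilinear_onD:
  assumes "symmetric_bilinear_on T h" "u \<in> T" "v \<in> T"
  shows "h u v = h v u"
    and "w \<in> T \<Longrightarrow> h (\<lambda>c. r *\<^sub>R u c + s *\<^sub>R v c) w = r * h u w + s * h v w"
  using assms unfolding symmetric_bilinear_on_def by simp_all

lemma symmetric_bilinear_on_sum_left:
  assumes h: "symmetric_bilinear_on T h"
    and closed: "\<forall>u\<in>T. \<forall>v\<in>T. \<forall>r s. (\<lambda>c. r *\<^sub>R u c + s *\<^sub>R v c) \<in> T"
    and I: "finite I" "I \<noteq> {}" and b: "b ` I \<subseteq> T" and w: "w \<in> T"
  shows "(\<lambda>c. \<Sum>i\<in>I. r i *\<^sub>R b i c) \<in> T \<and>
    h (\<lambda>c. \<Sum>i\<in>I. r i *\<^sub>R b i c) w = (\<Sum>i\<in>I. r i * h (b i) w)"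
  using I b
proof (induction I rule: finite_ne_induct)
  case (singleton i)
  have "h (\<lambda>c. r i *\<^sub>R b i c + 0 *\<^sub>R b i c) w = r i * h (b i) w + 0 * h (b i) w"
    using singleton w by (intro symmetric_bilinear_onD(2)[OF h]) auto
  moreover have "(\<lambda>c. r i *\<^sub>R b i c + 0 *\<^sub>R b i c) \<in> T" using closed singleton by blast
  ultimately show ?case by simp
next
  case (insert i I)
  let ?s = "\<lambda>c. \<Sum>i\<in>I. r i *\<^sub>R b i c"
  have s: "?s \<in> T" "h ?s w = (\<Sum>i\<in>I. r i * h (b i) w)" using insert by auto
  have "b i \<in> T" using insert by auto
  then have "h (\<lambda>c. r i *\<^sub>R b i c + 1 *\<^sub>R ?s c) w = r i * h (b i) w + 1 * h ?s w"
    using s(1) w by (intro symmetric_bilinear_onD(2)[OF h])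
  moreover have "(\<lambda>c. r i *\<^sub>R b i c + 1 *\<^sub>R ?s c) \<in> T" 
    using closed[rule_format, OF \<open>b i \<in> T\<close> s(1), of "r i" 1] .
  ultimately show ?case using insert.hyps s(2) by simp
qed

text \<open>
  In an orthonormal basis the form becomes the standard Minkowski form on coordinate vectors, with
  \<^term>\<open>i0\<close> as the time index.
\<close>

lemma lorentzian_coordinates:
  fixes T :: "('a, 'e::euclidean_space) tvec set"
  assumes h: "symmetric_bilinear_on T h" and sig: "lorentzian_signature T h"
    and closed: "\<forall>u\<in>T. \<forall>v\<in>T. \<forall>r s. (\<lambda>c. r *\<^sub>R u c + s *\<^sub>R v c) \<in> T"
  shows "\<exists>(r :: ('a, 'e) tvec \<Rightarrow> 'e \<Rightarrow> real) i0. \<forall>v\<in>T. \<forall>w\<in>T.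
    h v w = (\<Sum>i\<in>Basis - {i0}. r v i * r w i) - r v i0 * r w i0"
proof -
  obtain b :: "'e \<Rightarrow> ('a, 'e) tvec" and i0 where i0: "i0 \<in> Basis"
    and b: "\<And>i. i \<in> Basis \<Longrightarrow> b i \<in> T"
    and span: "\<And>v. v \<in> T \<Longrightarrow> \<exists>r. v = (\<lambda>c. \<Sum>i\<in>Basis. r i *\<^sub>R b i c)"
    and orth: "\<And>i j. i \<in> Basis \<Longrightarrow> j \<in> Basis \<Longrightarrow>
      h (b i) (b j) = (if i \<noteq> j then 0 else if i = i0 then - 1 else 1)"
    using sig unfolding lorentzian_signature_def by blast
  have bT: "b ` Basis \<subseteq> T" using b by blast
  obtain r where r: "\<And>v. v \<in> T \<Longrightarrow> v = (\<lambda>c. \<Sum>i\<in>Basis. r v i *\<^sub>R b i c)"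
    using span by metis
  have sum: "h v w = (\<Sum>i\<in>Basis. r v i * h (b i) w)" if "v \<in> T" "w \<in> T" for v w
    using symmetric_bilinear_on_sum_left[OF h closed finite_Basis nonempty_Basis bT \<open>w \<in> T\<close>, where r = "r v"]
    unfolding r[OF \<open>v \<in> T\<close>, symmetric] by blast
  have "h v w = (\<Sum>i\<in>Basis - {i0}. r v i * r w i) - r v i0 * r w i0"
    if v: "v \<in> T" and w: "w \<in> T" for v w
  proof -
    have bw: "h (b i) w = (if i = i0 then - r w i else r w i)" if i: "i \<in> Basis" for i
    proof -
      have "h (b i) w = h w (b i)"
        by (rule symmetric_bilinear_onD(1)[OF h b[OF i] w])
      also have "\<dots> = (\<Sum>j\<in>Basis. r w j * h (b j) (b i))" by (rule sum[OF w b[OF i]])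
      also have "\<dots> = (\<Sum>j\<in>Basis. if j = i then (if i = i0 then - r w i else r w i) else 0)"
        using i by (intro sum.cong) (auto simp: orth)
      finally show ?thesis using i by simp
    qed
    have "h v w = (\<Sum>i\<in>Basis. r v i * (if i = i0 then - r w i else r w i))"
      using sum[OF v w] bw by simp
    also have "\<dots> = r v i0 * - r w i0
        + (\<Sum>i\<in>Basis - {i0}. r v i * (if i = i0 then - r w i else r w i))"
      using i0 by (subst sum.remove[of _ i0]) auto
    also have "(\<Sum>i\<in>Basis - {i0}. r v i * (if i = i0 then - r w i else r w i))
        = (\<Sum>i\<in>Basis - {i0}. r v i * r w i)" by (intro sum.cong) auto
    finally show ?thesis by simp
  qed
  then show ?thesis by (intro exI[of _ r] exI[of _ i0] ballI)
qed

text \<open>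
  The spatial part of a timelike vector is shorter than its time coordinate. By the Cauchy-Schwarz
  inequality the time coordinates therefore decide the sign of the product of two timelike vectors:
  it is negative exactly if both time coordinates have the same sign. Having the same sign is
  transitive.
\<close>

lemma lorentzian_timelike_trans:
  fixes T :: "('a, 'e::euclidean_space) tvec set"
  assumes h: "symmetric_bilinear_on T h" and sig: "lorentzian_signature T h"
    and closed: "\<forall>u\<in>T. \<forall>v\<in>T. \<forall>r s. (\<lambda>c. r *\<^sub>R u c + s *\<^sub>R v c) \<in> T"
    and T: "u \<in> T" "v \<in> T" "w \<in> T"
    and timelike: "h u u < 0" "h v v < 0" "h w w < 0"
    and cones: "h u v < 0" "h v w < 0"
  shows "h u w < 0"
proof -
  obtain r :: "('a, 'e) tvec \<Rightarrow> 'e \<Rightarrow> real" and i0 where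
    r: "\<forall>v\<in>T. \<forall>w\<in>T. h v w = (\<Sum>i\<in>Basis - {i0}. r v i * r w i) - r v i0 * r w i0"
    using lorentzian_coordinates[OF h sig closed] by (elim exE) (rule that)
  have *: "h a b < 0 \<longleftrightarrow> 0 < r a i0 * r b i0"
    if ab: "a \<in> T" "b \<in> T" "h a a < 0" "h b b < 0" for a b
  proof -
    let ?S = "\<lambda>a b. \<Sum>i\<in>Basis - {i0}. r a i * r b i"
    have lt: "?S a a < (r a i0)\<^sup>2" "?S b b < (r b i0)\<^sup>2"
      using ab r[rule_format, of a a] r[rule_format, of b b] by (simp_all add: power2_eq_square)
    have "(?S a b)\<^sup>2 \<le> ?S a a * ?S b b"
      using Cauchy_Schwarz_ineq_sum[of "r a" "r b" "Basis - {i0}"] by (simp add: power2_eq_square)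
    also have "\<dots> < (r a i0)\<^sup>2 * (r b i0)\<^sup>2"
      using lt by (rule mult_strict_mono') (simp_all add: sum_nonneg)
    finally have "\<bar>?S a b\<bar>\<^sup>2 < \<bar>r a i0 * r b i0\<bar>\<^sup>2" by (simp only: power2_abs power_mult_distrib)
    then have "\<bar>?S a b\<bar> < \<bar>r a i0 * r b i0\<bar>" by (rule power2_less_imp_less) simp
    then show ?thesis using r[rule_format, OF ab(1,2)] by linarith
  qed
  have "0 < r u i0 * r v i0" "0 < r v i0 * r w i0"
    using *[OF T(1,2) timelike(1,2)] *[OF T(2,3) timelike(2,3)] cones by blast+
  then have "0 < r u i0 * r w i0" by (auto simp: zero_less_mult_iff)
  then show ?thesis using *[OF T(1,3) timelike(1,3)] by blast
qed

section \<open>Charts and tangent vectors\<close>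

locale atlas =
  fixes A :: "('a::{t2_space,second_countable_topology}, 'e::euclidean_space) chart set"
  assumes smooth_manifold: "smooth_manifold A"
begin

lemma chart:
  assumes "c \<in> A"
  shows open_dom_chart: "open (dom_chart c)"
    and open_coord_image_dom: "open (coord c ` dom_chart c)"
    and chart_homeomorphism: "homeomorphism (dom_chart c) (coord c ` dom_chart c) (coord c) (inv_coord c)"
  using smooth_manifold assms unfolding smooth_manifold_def is_chart_def by auto

lemma inv_coord_coord:
  assumes "c \<in> A" "p \<in> dom_chart c"
  shows "inv_coord c (coord c p) = p"
  using chart_homeomorphism assms by (meson homeomorphism_apply1)

lemma inv_coord_image:
  assumes c: "c \<in> A" and x: "x \<in> coord c ` (dom_chart c \<inter> S)"
  shows "inv_coord c x \<in> dom_chart c" "inv_coord c x \<in> S" "coord c (inv_coord c x) = x"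
  using x inv_coord_coord[OF c] by auto

lemma continuous_on_coord: "c \<in> A \<Longrightarrow> continuous_on (dom_chart c) (coord c)"
  using chart_homeomorphism by (meson homeomorphism_cont1)

lemma continuous_on_inv_coord: "c \<in> A \<Longrightarrow> continuous_on (coord c ` dom_chart c) (inv_coord c)"
  using chart_homeomorphism by (meson homeomorphism_cont2)

lemma open_coord_image:
  assumes c: "c \<in> A" and "open S"
  shows "open (coord c ` (dom_chart c \<inter> S))"
proof -
  have "coord c ` (dom_chart c \<inter> S) = coord c ` dom_chart c \<inter> inv_coord c -` S"
    using inv_coord_coord[OF c] by auto
  then show ?thesis
    using continuous_open_preimage[OF continuous_on_inv_coord[OF c] open_coord_image_dom[OF c] \<open>open S\<close>]
    by simp
qed

lemma open_inv_coord_image: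
  assumes c: "c \<in> A" and "open X" "X \<subseteq> coord c ` dom_chart c"
  shows "open (inv_coord c ` X)"
proof -
  have "inv_coord c ` X = dom_chart c \<inter> coord c -` X"
    using assms(3) inv_coord_coord[OF c] by force
  then show ?thesis
    using continuous_open_preimage[OF continuous_on_coord[OF c] open_dom_chart[OF c] \<open>open X\<close>]
    by simp
qed

lemma smooth_transition:
  "c \<in> A \<Longrightarrow> d \<in> A \<Longrightarrow> smooth_on (coord c ` (dom_chart c \<inter> dom_chart d)) (transition c d)"
  using smooth_manifold unfolding smooth_manifold_def by blast

abbreviation dtransition :: "('a, 'e) chart \<Rightarrow> ('a, 'e) chart \<Rightarrow> 'a \<Rightarrow> 'e \<Rightarrow> 'e" where
  "dtransition c d p \<equiv> frechet_derivative (transition c d) (at (coord c p))"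

lemma has_derivative_transition:
  assumes "c \<in> A" "d \<in> A" "p \<in> dom_chart c" "p \<in> dom_chart d"
  shows "(transition c d has_derivative dtransition c d p) (at (coord c p))"
proof -
  have "coord c p \<in> coord c ` (dom_chart c \<inter> dom_chart d)" using assms(3,4) by blast
  then have "transition c d differentiable (at (coord c p))"
    by (rule smooth_on_imp_C1(1)[OF smooth_transition[OF assms(1,2)]])
  then show ?thesis by (rule frechet_derivative_works[THEN iffD1])
qed

lemma linear_dtransition:
  assumes "c \<in> A" "d \<in> A" "p \<in> dom_chart c" "p \<in> dom_chart d"
  shows "linear (dtransition c d p)"
  using has_derivative_transition[OF assms] has_derivative_linear by blast

lemma dtransition_self:
  assumes "c \<in> A" "p \<in> dom_chart c"
  shows "dtransition c c p x = x"
proof -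
  have "(transition c c has_derivative (\<lambda>x. x)) (at (coord c p))"
    by (rule has_derivative_transform_within_open[OF has_derivative_ident open_coord_image_dom[OF assms(1)]])
      (use assms inv_coord_coord[OF assms(1)] in auto)
  then show ?thesis using frechet_derivative_at by metis
qed

lemma dtransition_trans:
  assumes c: "c \<in> A" and d: "d \<in> A" and e: "e \<in> A"
    and p: "p \<in> dom_chart c" "p \<in> dom_chart d" "p \<in> dom_chart e"
  shows "dtransition d e p (dtransition c d p x) = dtransition c e p x"
proof -
  have q: "transition c d (coord c p) = coord d p" using inv_coord_coord[OF c p(1)] by simp
  have "(transition d e \<circ> transition c d has_derivative dtransition d e p \<circ> dtransition c d p)
      (at (coord c p))"
    using has_derivative_transition[OF c d p(1,2)] has_derivative_transition[OF d e p(2,3)]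
    by (intro diff_chain_at) (simp_all add: q[unfolded comp_def])
  then have "(transition c e has_derivative dtransition d e p \<circ> dtransition c d p) (at (coord c p))"
    by (rule has_derivative_transform_within_open[OF _ open_coord_image[OF c open_dom_chart[OF d]]])
      (use p inv_coord_coord[OF c] inv_coord_coord[OF d] in auto)
  then show ?thesis using frechet_derivative_at by (metis comp_apply)
qed

lemma coord_vec_in_tangent_space:
  assumes "c \<in> A" "p \<in> dom_chart c"
  shows "coord_vec A c p x \<in> tangent_space A p"
  using assms dtransition_trans by (auto simp: tangent_space_def coord_vec_def)

lemma coord_vec_self:
  assumes "c \<in> A" "p \<in> dom_chart c"
  shows "coord_vec A c p x c = x"
  using assms dtransition_self by (simp add: coord_vec_def)

lemma tangent_eq_coord_vec:
  assumes "c \<in> A" "p \<in> dom_chart c" "v \<in> tangent_space A p"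
  shows "v = coord_vec A c p (v c)"
proof
  fix d
  show "v d = coord_vec A c p (v c) d"
  proof (cases "d \<in> A \<and> p \<in> dom_chart d")
    case True
    then have "v d = dtransition c d p (v c)" using assms unfolding tangent_space_def by blast
    then show ?thesis using True by (simp add: coord_vec_def)
  next
    case False
    then have "v d = 0" using assms(3) unfolding tangent_space_def by blast
    then show ?thesis using False by (auto simp: coord_vec_def)
  qed
qed

lemma coord_vec_linear:
  assumes "c \<in> A" "p \<in> dom_chart c"
  shows "coord_vec A c p (r *\<^sub>R x + s *\<^sub>R y) =
    (\<lambda>d. r *\<^sub>R coord_vec A c p x d + s *\<^sub>R coord_vec A c p y d)"
proof
  fix d
  show "coord_vec A c p (r *\<^sub>R x + s *\<^sub>R y) d =
    r *\<^sub>R coord_vec A c p x d + s *\<^sub>R coord_vec A c p y d"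
    using linear_dtransition[OF assms(1) _ assms(2), of d]
    by (simp add: coord_vec_def linear_add linear_cmul)
qed

text \<open>
  Closure under linear combinations is inherited from the model space through the components in
  one chart.
\<close>

lemma tangent_space_closed:
  assumes p: "p \<in> points A" and "u \<in> tangent_space A p" "v \<in> tangent_space A p"
  shows "(\<lambda>c. r *\<^sub>R u c + s *\<^sub>R v c) \<in> tangent_space A p"
proof -
  obtain c where c: "c \<in> A" "p \<in> dom_chart c" using p by (auto simp: points_def)
  have "coord_vec A c p (r *\<^sub>R u c + s *\<^sub>R v c) = (\<lambda>d. r *\<^sub>R u d + s *\<^sub>R v d)"
    using coord_vec_linear[OF c, of r "u c" s "v c"]
    unfolding tangent_eq_coord_vec[OF c assms(2), symmetric] tangent_eq_coord_vec[OF c assms(3), symmetric] .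
  then show ?thesis using coord_vec_in_tangent_space[OF c] by metis
qed

end

section \<open>Piecewise continuously differentiable curves\<close>

lemma C1_curve_onD:
  assumes "C1_curve_on A u v \<gamma>"
  shows "continuous_on {u..v} \<gamma>" and "\<gamma> ` {u..v} \<subseteq> points A"
  using assms unfolding C1_curve_on_def by simp_all

lemma C1_curve_onI:
  assumes "continuous_on {u..v} \<gamma>" and "\<gamma> ` {u..v} \<subseteq> points A"
    and "\<And>c t. c \<in> A \<Longrightarrow> t \<in> {u..v} \<Longrightarrow> \<gamma> t \<in> dom_chart c \<Longrightarrow>
      ((coord c \<circ> \<gamma>) has_vector_derivative D c t) (at t within {u..v})"
    and "\<And>c. c \<in> A \<Longrightarrow> continuous_on {t\<in>{u..v}. \<gamma> t \<in> dom_chart c} (D c)"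
  shows "C1_curve_on A u v \<gamma>"
  unfolding C1_curve_on_def using assms by blast

lemma velocity_eqI:
  fixes A :: "('a::topological_space, 'e::euclidean_space) chart set"
  assumes "u < v" "t \<in> {u..v}" "c \<in> A" "\<gamma> t \<in> dom_chart c"
    and "((coord c \<circ> \<gamma>) has_vector_derivative D) (at t within {u..v})"
  shows "velocity A u v \<gamma> t c = D"
  using vector_derivative_within_closed_interval[OF assms(1,2,5)] assms(3,4)
  by (simp add: velocity_def)

lemma C1_curve_on_chart:
  fixes A :: "('a::topological_space, 'e::euclidean_space) chart set"
  assumes \<gamma>: "C1_curve_on A u v \<gamma>" and uv: "u < v" and c: "c \<in> A"
  shows "\<And>t. t \<in> {u..v} \<Longrightarrow> \<gamma> t \<in> dom_chart c \<Longrightarrow>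
      ((coord c \<circ> \<gamma>) has_vector_derivative velocity A u v \<gamma> t c) (at t within {u..v})"
    and "continuous_on {t\<in>{u..v}. \<gamma> t \<in> dom_chart c} (\<lambda>t. velocity A u v \<gamma> t c)"
proof -
  obtain D where D: "\<And>t. t \<in> {u..v} \<Longrightarrow> \<gamma> t \<in> dom_chart c \<Longrightarrow>
      ((coord c \<circ> \<gamma>) has_vector_derivative D t) (at t within {u..v})"
    and cont: "continuous_on {t\<in>{u..v}. \<gamma> t \<in> dom_chart c} D"
    using \<gamma> c unfolding C1_curve_on_def by blast
  have eq: "velocity A u v \<gamma> t c = D t" if "t \<in> {u..v}" "\<gamma> t \<in> dom_chart c" for t
    using velocity_eqI[OF uv that(1) c that(2) D[OF that]] .
  show "((coord c \<circ> \<gamma>) has_vector_derivative velocity A u v \<gamma> t c) (at t within {u..v})"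
    if "t \<in> {u..v}" "\<gamma> t \<in> dom_chart c" for t
    unfolding eq[OF that] by (rule D[OF that])
  show "continuous_on {t\<in>{u..v}. \<gamma> t \<in> dom_chart c} (\<lambda>t. velocity A u v \<gamma> t c)"
    by (rule continuous_on_eq[OF cont]) (simp add: eq)
qed

text \<open>
  The slope 1 is needed to join two curves whose parameter intervals do not match, the slope -1 to
  reverse time.
\<close>

lemma C1_curve_on_affine:
  fixes A :: "('a::topological_space, 'e::euclidean_space) chart set" and \<sigma> h :: real
  defines "\<phi> \<equiv> \<lambda>t. \<sigma> * t + h"
  assumes \<gamma>: "C1_curve_on A u v \<gamma>" and uv: "u < v" "u' < v'" and im: "\<phi> ` {u'..v'} = {u..v}"
  shows "C1_curve_on A u' v' (\<gamma> \<circ> \<phi>)"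
    and "\<And>t. t \<in> {u'..v'} \<Longrightarrow>
      velocity A u' v' (\<gamma> \<circ> \<phi>) t = (\<lambda>c. \<sigma> *\<^sub>R velocity A u v \<gamma> (\<phi> t) c)"
proof -
  have cont: "continuous_on T \<phi>" for T unfolding \<phi>_def by (intro continuous_intros)
  have mem: "\<phi> t \<in> {u..v}" if "t \<in> {u'..v'}" for t using im that by blast
  have deriv: "((coord c \<circ> (\<gamma> \<circ> \<phi>)) has_vector_derivative \<sigma> *\<^sub>R velocity A u v \<gamma> (\<phi> t) c)
      (at t within {u'..v'})" if "c \<in> A" "t \<in> {u'..v'}" "\<gamma> (\<phi> t) \<in> dom_chart c" for c t
  proof -
    have "(\<phi> has_vector_derivative \<sigma>) (at t within {u'..v'})"
      unfolding \<phi>_def by (auto intro!: derivative_eq_intros)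
    moreover have "((coord c \<circ> \<gamma>) has_vector_derivative velocity A u v \<gamma> (\<phi> t) c)
        (at (\<phi> t) within \<phi> ` {u'..v'})"
      unfolding im by (rule C1_curve_on_chart(1)[OF \<gamma> uv(1) that(1) mem[OF that(2)] that(3)])
    ultimately show ?thesis
      using vector_diff_chain_within by (metis comp_assoc)
  qed
  have "continuous_on {t\<in>{u'..v'}. (\<gamma> \<circ> \<phi>) t \<in> dom_chart c}
      (\<lambda>t. \<sigma> *\<^sub>R velocity A u v \<gamma> (\<phi> t) c)" if "c \<in> A" for c
    by (intro continuous_intros continuous_on_compose2[OF C1_curve_on_chart(2)[OF \<gamma> uv(1) that] cont])
      (use mem in auto)
  moreover have "continuous_on {u'..v'} (\<gamma> \<circ> \<phi>)"
    using continuous_on_compose[OF cont, of "{u'..v'}" \<gamma>] C1_curve_onD(1)[OF \<gamma>] im by simp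
  moreover have "(\<gamma> \<circ> \<phi>) ` {u'..v'} \<subseteq> points A"
    using C1_curve_onD(2)[OF \<gamma>] mem by auto
  ultimately show "C1_curve_on A u' v' (\<gamma> \<circ> \<phi>)"
    by (intro C1_curve_onI[where D = "\<lambda>c t. \<sigma> *\<^sub>R velocity A u v \<gamma> (\<phi> t) c"]) (simp_all add: deriv)
  show "velocity A u' v' (\<gamma> \<circ> \<phi>) t = (\<lambda>c. \<sigma> *\<^sub>R velocity A u v \<gamma> (\<phi> t) c)"
    if t: "t \<in> {u'..v'}" for t
  proof
    fix c
    show "velocity A u' v' (\<gamma> \<circ> \<phi>) t c = \<sigma> *\<^sub>R velocity A u v \<gamma> (\<phi> t) c"
    proof (cases "c \<in> A \<and> \<gamma> (\<phi> t) \<in> dom_chart c")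
      case True
      then show ?thesis using velocity_eqI[OF uv(2) t _ _ deriv[OF _ t]] by simp
    next
      case False
      then show ?thesis by (auto simp: velocity_def)
    qed
  qed
qed

text \<open>
  One-sided derivatives at the ends of the interval see only the values on the interval, so a curve
  that is defined by cases has the velocity of the relevant part also at the joining point.
\<close>

lemma C1_curve_on_cong:
  fixes A :: "('a::topological_space, 'e::euclidean_space) chart set"
  assumes eq: "\<forall>t\<in>{u..v}. \<gamma> t = \<delta> t"
    and \<gamma>: "C1_curve_on A u v \<gamma>" and uv: "u < v"
  shows "C1_curve_on A u v \<delta>"
    and "\<And>t. t \<in> {u..v} \<Longrightarrow> velocity A u v \<delta> t = velocity A u v \<gamma> t"
proof -
  have deriv: "((coord c \<circ> \<delta>) has_vector_derivative velocity A u v \<gamma> t c) (at t within {u..v})"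
    if "c \<in> A" "t \<in> {u..v}" "\<delta> t \<in> dom_chart c" for c t
    by (rule has_vector_derivative_transform[OF that(2) _ C1_curve_on_chart(1)[OF \<gamma> uv that(1,2)]])
      (use eq that in auto)
  have "{t\<in>{u..v}. \<delta> t \<in> dom_chart c} = {t\<in>{u..v}. \<gamma> t \<in> dom_chart c}" for c :: "('a, 'e) chart"
    using eq by auto
  then have "continuous_on {t\<in>{u..v}. \<delta> t \<in> dom_chart c} (\<lambda>t. velocity A u v \<gamma> t c)"
    if "c \<in> A" for c
    using C1_curve_on_chart(2)[OF \<gamma> uv that] by simp
  moreover have "continuous_on {u..v} \<delta>"
    by (rule continuous_on_eq[OF C1_curve_onD(1)[OF \<gamma>]]) (rule eq[rule_format])
  moreover have "\<delta> ` {u..v} \<subseteq> points A" using C1_curve_onD(2)[OF \<gamma>] eq by auto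
  ultimately show "C1_curve_on A u v \<delta>"
    by (intro C1_curve_onI[where D = "\<lambda>c t. velocity A u v \<gamma> t c"] deriv)
  show "velocity A u v \<delta> t = velocity A u v \<gamma> t" if t: "t \<in> {u..v}" for t
  proof
    fix c
    show "velocity A u v \<delta> t c = velocity A u v \<gamma> t c"
    proof (cases "c \<in> A \<and> \<delta> t \<in> dom_chart c")
      case True
      then show ?thesis using velocity_eqI[OF uv t _ _ deriv[OF _ t]] by simp
    next
      case False
      then show ?thesis using eq[rule_format, OF t] by (auto simp: velocity_def)
    qed
  qed
qed

lemma piecewise_C1_curve_inI:
  assumes "a < b" "finite P"
    and "\<And>u v. a \<le> u \<Longrightarrow> u < v \<Longrightarrow> v \<le> b \<Longrightarrow> {u<..<v} \<inter> P = {} \<Longrightarrow>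
      C1_curve_on A u v \<gamma> \<and> (\<forall>t\<in>{u..v}. velocity A u v \<gamma> t \<in> K (\<gamma> t))"
  shows "piecewise_C1_curve_in A K a b \<gamma>"
  unfolding piecewise_C1_curve_in_def using assms(1,2)
  by (intro conjI exI[of _ P]) (use assms(3) in simp_all)

lemma piecewise_C1_curve_inE:
  assumes "piecewise_C1_curve_in A K a b \<gamma>"
  obtains P where "a < b" "finite P"
    "\<forall>u v. a \<le> u \<longrightarrow> u < v \<longrightarrow> v \<le> b \<longrightarrow> {u<..<v} \<inter> P = {} \<longrightarrow>
      C1_curve_on A u v \<gamma> \<and> (\<forall>t\<in>{u..v}. velocity A u v \<gamma> t \<in> K (\<gamma> t))"
proof -
  obtain P where P: "finite P"
    "\<forall>u v. a \<le> u \<and> u < v \<and> v \<le> b \<and> {u<..<v} \<inter> P = {} \<longrightarrow>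
      C1_curve_on A u v \<gamma> \<and> (\<forall>t\<in>{u..v}. velocity A u v \<gamma> t \<in> K (\<gamma> t))"
    using assms unfolding piecewise_C1_curve_in_def by (elim conjE exE) (rule that)
  show ?thesis
  proof (rule that[OF _ P(1)])
    show "a < b" using assms unfolding piecewise_C1_curve_in_def by (rule conjunct1)
  qed (use P(2) in simp_all)
qed

lemma piecewise_C1_curve_in_mono:
  assumes "piecewise_C1_curve_in A K a b \<gamma>" and K: "\<And>p. p \<in> points A \<Longrightarrow> K p \<subseteq> K' p"
  shows "piecewise_C1_curve_in A K' a b \<gamma>"
proof -
  obtain P where ab: "a < b" and P: "finite P"
    and \<gamma>': "\<forall>u v. a \<le> u \<longrightarrow> u < v \<longrightarrow> v \<le> b \<longrightarrow> {u<..<v} \<inter> P = {} \<longrightarrow>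
      C1_curve_on A u v \<gamma> \<and> (\<forall>t\<in>{u..v}. velocity A u v \<gamma> t \<in> K (\<gamma> t))"
    using assms(1) by (rule piecewise_C1_curve_inE) (rule that)
  note \<gamma> = \<gamma>'[rule_format]
  show ?thesis
  proof (rule piecewise_C1_curve_inI[OF ab P])
    fix u v assume "a \<le> u" "u < v" "v \<le> b" "{u<..<v} \<inter> P = {}"
    note uv = \<gamma>[OF this]
    have "velocity A u v \<gamma> t \<in> K' (\<gamma> t)" if "t \<in> {u..v}" for t
    proof -
      have "\<gamma> t \<in> points A" using C1_curve_onD(2) uv that by blast
      then show ?thesis using K uv that by blast
    qed
    then show "C1_curve_on A u v \<gamma> \<and> (\<forall>t\<in>{u..v}. velocity A u v \<gamma> t \<in> K' (\<gamma> t))" using uv by blast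
  qed
qed

lemma piecewise_C1_curve_in_affine:
  fixes A :: "('a::topological_space, 'e::euclidean_space) chart set" and \<sigma> h :: real
  defines "\<phi> \<equiv> \<lambda>t. \<sigma> * t + h"
  assumes "piecewise_C1_curve_in A K a b \<gamma>" and \<sigma>: "\<sigma> \<noteq> 0" and ab': "a' < b'"
    and im: "\<phi> ` {a'..b'} = {a..b}"
    and K: "\<And>p w. w \<in> K p \<Longrightarrow> (\<lambda>c. \<sigma> *\<^sub>R w c) \<in> K' p"
  shows "piecewise_C1_curve_in A K' a' b' (\<gamma> \<circ> \<phi>)"
proof -
  obtain P where ab: "a < b" and P: "finite P"
    and \<gamma>': "\<forall>u v. a \<le> u \<longrightarrow> u < v \<longrightarrow> v \<le> b \<longrightarrow> {u<..<v} \<inter> P = {} \<longrightarrow>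
      C1_curve_on A u v \<gamma> \<and> (\<forall>t\<in>{u..v}. velocity A u v \<gamma> t \<in> K (\<gamma> t))"
    using assms(2) by (rule piecewise_C1_curve_inE) (rule that)
  note \<gamma> = \<gamma>'[rule_format]
  have inj: "inj \<phi>" using \<sigma> by (auto simp: \<phi>_def inj_on_def)
  have "C1_curve_on A u' v' (\<gamma> \<circ> \<phi>) \<and>
      (\<forall>t\<in>{u'..v'}. velocity A u' v' (\<gamma> \<circ> \<phi>) t \<in> K' ((\<gamma> \<circ> \<phi>) t))"
    if u'v': "a' \<le> u'" "u' < v'" "v' \<le> b'" and gap: "{u'<..<v'} \<inter> \<phi> -` P = {}" for u' v'
  proof -
    define u v where "u = min (\<phi> u') (\<phi> v')" and "v = max (\<phi> u') (\<phi> v')"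
    have im': "\<phi> ` {u'..v'} = {u..v}"
      using u'v' \<sigma> unfolding u_def v_def \<phi>_def image_affinity_atLeastAtMost
      by (auto simp: min_def max_def)
    have "\<phi> u' \<noteq> \<phi> v'" using u'v'(2) injD[OF inj] by blast
    then have uv: "u < v" by (auto simp: u_def v_def min_def max_def)
    have "{u..v} \<subseteq> {a..b}" using im im' u'v' by (metis atLeastatMost_subset_iff image_mono)
    then have "a \<le> u" "v \<le> b" using uv by auto
    moreover have "{u<..<v} \<inter> P = {}"
    proof -
      have "x \<notin> P" if x: "x \<in> {u<..<v}" for x
      proof -
        have "x \<in> \<phi> ` {u'..v'}" unfolding im' using x by simp
        then obtain t where t: "t \<in> {u'..v'}" "x = \<phi> t" by blast
        have "x \<noteq> \<phi> u'" "x \<noteq> \<phi> v'" using x by (auto simp: u_def v_def)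
        then have "t \<in> {u'<..<v'}" using t by (auto simp: less_le)
        then show ?thesis using gap t by auto
      qed
      then show ?thesis by blast
    qed
    ultimately have *: "C1_curve_on A u v \<gamma>" "\<And>t. t \<in> {u..v} \<Longrightarrow> velocity A u v \<gamma> t \<in> K (\<gamma> t)"
      using \<gamma>[OF _ uv] by blast+
    note affine = C1_curve_on_affine[OF *(1) uv u'v'(2), of \<sigma> h, folded \<phi>_def, OF im']
    have "velocity A u' v' (\<gamma> \<circ> \<phi>) t \<in> K' ((\<gamma> \<circ> \<phi>) t)" if "t \<in> {u'..v'}" for t
    proof -
      have "\<phi> t \<in> {u..v}" using im' that by blast
      then have "(\<lambda>c. \<sigma> *\<^sub>R velocity A u v \<gamma> (\<phi> t) c) \<in> K' (\<gamma> (\<phi> t))" using *(2) K by blast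
      then show ?thesis using affine(2)[OF that] by (simp add: \<phi>_def)
    qed
    then show ?thesis using affine(1) by blast
  qed
  moreover have "finite (\<phi> -` P)" using P inj by (rule finite_vimageI)
  ultimately show ?thesis using ab' by (intro piecewise_C1_curve_inI)
qed

lemma piecewise_C1_curve_in_join:
  fixes A :: "('a::topological_space, 'e::euclidean_space) chart set"
  assumes "piecewise_C1_curve_in A K a b \<gamma>" "piecewise_C1_curve_in A K b c \<delta>"
    and eq: "\<gamma> b = \<delta> b"
  shows "piecewise_C1_curve_in A K a c (\<lambda>t. if t \<le> b then \<gamma> t else \<delta> t)"
    (is "piecewise_C1_curve_in A K a c ?\<epsilon>")
proof -
  obtain P where ab: "a < b" and P: "finite P"
    and \<gamma>': "\<forall>u v. a \<le> u \<longrightarrow> u < v \<longrightarrow> v \<le> b \<longrightarrow> {u<..<v} \<inter> P = {} \<longrightarrow>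
      C1_curve_on A u v \<gamma> \<and> (\<forall>t\<in>{u..v}. velocity A u v \<gamma> t \<in> K (\<gamma> t))"
    using assms(1) by (rule piecewise_C1_curve_inE) (rule that)
  note \<gamma> = \<gamma>'[rule_format]
  obtain Q where bc: "b < c" and Q: "finite Q"
    and \<delta>': "\<forall>u v. b \<le> u \<longrightarrow> u < v \<longrightarrow> v \<le> c \<longrightarrow> {u<..<v} \<inter> Q = {} \<longrightarrow>
      C1_curve_on A u v \<delta> \<and> (\<forall>t\<in>{u..v}. velocity A u v \<delta> t \<in> K (\<delta> t))"
    using assms(2) by (rule piecewise_C1_curve_inE) (rule that)
  note \<delta> = \<delta>'[rule_format]
  have "C1_curve_on A u v ?\<epsilon> \<and> (\<forall>t\<in>{u..v}. velocity A u v ?\<epsilon> t \<in> K (?\<epsilon> t))"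
    if uv: "a \<le> u" "u < v" "v \<le> c" and gap: "{u<..<v} \<inter> insert b (P \<union> Q) = {}" for u v
  proof -
    have gaps: "{u<..<v} \<inter> P = {}" "{u<..<v} \<inter> Q = {}" "b \<notin> {u<..<v}" using gap by auto
    then consider "v \<le> b" | "b \<le> u" by fastforce
    then show ?thesis
    proof cases
      case 1
      have *: "C1_curve_on A u v \<gamma>" "\<forall>t\<in>{u..v}. velocity A u v \<gamma> t \<in> K (\<gamma> t)"
        using \<gamma>[OF uv(1,2) 1 gaps(1)] by blast+
      have same: "\<forall>t\<in>{u..v}. \<gamma> t = ?\<epsilon> t" using 1 by simp
      note cong = C1_curve_on_cong[OF same *(1) uv(2)]
      have "velocity A u v ?\<epsilon> t \<in> K (?\<epsilon> t)" if "t \<in> {u..v}" for t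
        unfolding cong(2)[OF that] same[rule_format, OF that, symmetric] using *(2) that by blast
      then show ?thesis using cong(1) by blast
    next
      case 2
      have *: "C1_curve_on A u v \<delta>" "\<forall>t\<in>{u..v}. velocity A u v \<delta> t \<in> K (\<delta> t)"
        using \<delta>[OF 2 uv(2,3) gaps(2)] by blast+
      have same: "\<forall>t\<in>{u..v}. \<delta> t = ?\<epsilon> t"
      proof
        fix t assume "t \<in> {u..v}"
        then have "t = b \<or> \<not> t \<le> b" using 2 by auto
        then show "\<delta> t = ?\<epsilon> t" using eq by auto
      qed
      note cong = C1_curve_on_cong[OF same *(1) uv(2)]
      have "velocity A u v ?\<epsilon> t \<in> K (?\<epsilon> t)" if "t \<in> {u..v}" for t
        unfolding cong(2)[OF that] same[rule_format, OF that, symmetric] using *(2) that by blast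
      then show ?thesis using cong(1) by blast
    qed
  qed
  moreover have "finite (insert b (P \<union> Q))" using P Q by simp
  moreover have "a < c" using ab bc by simp
  ultimately show ?thesis by (intro piecewise_C1_curve_inI)
qed

text \<open>
  A property is carried along a compact interval if every point \<^term>\<open>x\<close> has a neighbourhood in which
  it is carried to \<^term>\<open>x\<close> from the left and away from \<^term>\<open>x\<close> to the right. Restricting the local
  hypothesis to intervals with the endpoint \<^term>\<open>x\<close> matters for piecewise curves, because \<^term>\<open>x\<close> may
  be a break point.
\<close>

lemma real_interval_induct_forward:
  fixes a b :: real
  assumes ab: "a \<le> b" and Q: "Q a"
    and step: "\<And>x. x \<in> {a..b} \<Longrightarrow> \<exists>d>0. \<forall>s\<in>{a..b}. \<forall>t\<in>{a..b}.
      s < t \<and> t - s < d \<and> (s = x \<or> t = x) \<and> Q s \<longrightarrow> Q t"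
  shows "Q b"
proof -
  have "a \<le> a \<and> b \<le> b \<longrightarrow> Q a \<longrightarrow> Q b"
  proof (rule Bolzano[where P = "\<lambda>s t. a \<le> s \<and> t \<le> b \<longrightarrow> Q s \<longrightarrow> Q t", OF ab])
    fix x assume "a \<le> x" "x \<le> b"
    then have "x \<in> {a..b}" by simp
    from step[OF this] obtain d where d: "d > 0"
      "\<forall>s\<in>{a..b}. \<forall>t\<in>{a..b}. s < t \<and> t - s < d \<and> (s = x \<or> t = x) \<and> Q s \<longrightarrow> Q t"
      by (elim exE conjE) (rule that)
    show "\<exists>d>0. \<forall>s t. s \<le> x \<and> x \<le> t \<and> t - s < d \<longrightarrow> a \<le> s \<and> t \<le> b \<longrightarrow> Q s \<longrightarrow> Q t"
    proof (intro exI[of _ d] conjI allI impI d(1))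
      fix s t assume st: "s \<le> x \<and> x \<le> t \<and> t - s < d" "a \<le> s \<and> t \<le> b" and "Q s"
      have "Q x" using \<open>Q s\<close> d(2)[rule_format, of s x] st by (cases "s = x") auto
      then show "Q t" using d(2)[rule_format, of x t] st by (cases "t = x") auto
    qed
  qed auto
  then show ?thesis using Q by simp
qed

text \<open>
  A property of points is carried along a whole curve if every point of the manifold has a
  neighbourhood within which it is carried along each smooth piece. This reduces statements about
  causal curves to computations in a single chart.
\<close>

lemma piecewise_C1_curve_induct:
  fixes A :: "('a::topological_space, 'e::euclidean_space) chart set"
  assumes "piecewise_C1_curve_in A K a b \<gamma>" and start: "Q (\<gamma> a)"
    and local: "\<And>p. p \<in> points A \<Longrightarrow> \<exists>N. open N \<and> p \<in> N \<and>
      (\<forall>u v. u < v \<and> C1_curve_on A u v \<gamma> \<and> (\<forall>t\<in>{u..v}. velocity A u v \<gamma> t \<in> K (\<gamma> t)) \<and>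
        \<gamma> ` {u..v} \<subseteq> N \<and> Q (\<gamma> u) \<longrightarrow> Q (\<gamma> v))"
  shows "Q (\<gamma> b)"
proof -
  obtain P where ab: "a < b" and P: "finite P"
    and \<gamma>': "\<forall>u v. a \<le> u \<longrightarrow> u < v \<longrightarrow> v \<le> b \<longrightarrow> {u<..<v} \<inter> P = {} \<longrightarrow>
      C1_curve_on A u v \<gamma> \<and> (\<forall>t\<in>{u..v}. velocity A u v \<gamma> t \<in> K (\<gamma> t))"
    using assms(1) by (rule piecewise_C1_curve_inE) (rule that)
  note \<gamma> = \<gamma>'[rule_format]
  \<comment> \<open>Continuity is available only on the smooth pieces, so these are treated before the break points.\<close>
  have piece: "Q (\<gamma> v)" if uv: "a \<le> u" "u < v" "v \<le> b" "{u<..<v} \<inter> P = {}" and Qu: "Q (\<gamma> u)" for u v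
  proof (rule real_interval_induct_forward[of u v "\<lambda>t. Q (\<gamma> t)"])
    fix x assume x: "x \<in> {u..v}"
    have curve: "C1_curve_on A u v \<gamma>" using \<gamma>[OF uv] by blast
    then have "\<gamma> x \<in> points A" using C1_curve_onD(2) x by blast
    from local[OF this] obtain N where N: "open N" "\<gamma> x \<in> N"
      and N': "\<forall>u v. u < v \<and> C1_curve_on A u v \<gamma> \<and>
        (\<forall>t\<in>{u..v}. velocity A u v \<gamma> t \<in> K (\<gamma> t)) \<and> \<gamma> ` {u..v} \<subseteq> N \<and> Q (\<gamma> u) \<longrightarrow> Q (\<gamma> v)"
      by (elim exE conjE) (rule that)
    have "(\<gamma> \<longlongrightarrow> \<gamma> x) (at x within {u..v})"
      using C1_curve_onD(1)[OF curve] x by (simp add: continuous_on)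
    then have "\<forall>\<^sub>F t in at x within {u..v}. \<gamma> t \<in> N"
      using N topological_tendstoD by blast
    then obtain d where d: "d > 0" "\<And>t. t \<in> {u..v} \<Longrightarrow> t \<noteq> x \<Longrightarrow> dist t x < d \<Longrightarrow> \<gamma> t \<in> N"
      unfolding eventually_at by blast
    have "Q (\<gamma> t)" if st: "s \<in> {u..v}" "t \<in> {u..v}" "s < t" "t - s < d" "s = x \<or> t = x" "Q (\<gamma> s)"
      for s t
    proof (rule N'[rule_format, of s t], intro conjI)
      have "{s<..<t} \<subseteq> {u<..<v}" using st by auto
      then have "a \<le> s" "t \<le> b" "{s<..<t} \<inter> P = {}" using st uv by auto
      from \<gamma>[OF this(1) \<open>s < t\<close> this(2,3)]
      show "C1_curve_on A s t \<gamma>" "\<forall>r\<in>{s..t}. velocity A s t \<gamma> r \<in> K (\<gamma> r)" by blast+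
      have "\<gamma> r \<in> N" if "r \<in> {s..t}" for r
      proof (cases "r = x")
        case False
        have "dist r x < d" using that st by (auto simp: dist_real_def)
        then show ?thesis using d(2)[of r] False that st by auto
      qed (use N in simp)
      then show "\<gamma> ` {s..t} \<subseteq> N" by blast
    qed (use st in auto)
    then show "\<exists>d>0. \<forall>s\<in>{u..v}. \<forall>t\<in>{u..v}. s < t \<and> t - s < d \<and> (s = x \<or> t = x) \<and> Q (\<gamma> s) \<longrightarrow> Q (\<gamma> t)"
      using d(1) by blast
  qed (use uv Qu in auto)
  show ?thesis
  proof (rule real_interval_induct_forward[of a b "\<lambda>t. Q (\<gamma> t)"])
    fix x assume x: "x \<in> {a..b}"
    obtain d where d: "d > 0" "\<And>y. y \<in> P \<Longrightarrow> y \<noteq> x \<Longrightarrow> d \<le> dist x y"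
      using finite_set_avoid[OF P] by blast
    have "Q (\<gamma> t)" if st: "s \<in> {a..b}" "t \<in> {a..b}" "s < t" "t - s < d" "s = x \<or> t = x" "Q (\<gamma> s)"
      for s t
    proof (rule piece[OF _ \<open>s < t\<close> _ _ \<open>Q (\<gamma> s)\<close>])
      have "y \<notin> P" if "y \<in> {s<..<t}" for y
        using d(2)[of y] that st by (auto simp: dist_real_def)
      then show "{s<..<t} \<inter> P = {}" by blast
    qed (use st in auto)
    then show "\<exists>d>0. \<forall>s\<in>{a..b}. \<forall>t\<in>{a..b}. s < t \<and> t - s < d \<and> (s = x \<or> t = x) \<and> Q (\<gamma> s) \<longrightarrow> Q (\<gamma> t)"
      using d(1) by blast
  qed (use ab start in auto)
qed

context atlas
begin

text \<open>
  Curves are constructed in a chart. Their coordinate expression in any other chart arises by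
  composition with a transition map, and the chain rule turns its derivative into the component of
  one and the same tangent vector.
\<close>

lemma C1_curve_on_inv_coord:
  assumes c: "c \<in> A" and uv: "u < v" and y: "y ` {u..v} \<subseteq> coord c ` dom_chart c"
    and y': "\<And>t. t \<in> {u..v} \<Longrightarrow> (y has_vector_derivative y' t) (at t within {u..v})"
    and cont': "continuous_on {u..v} y'"
  shows "C1_curve_on A u v (inv_coord c \<circ> y)"
    and "\<And>t. t \<in> {u..v} \<Longrightarrow>
      velocity A u v (inv_coord c \<circ> y) t = coord_vec A c (inv_coord c (y t)) (y' t)"
proof -
  let ?\<gamma> = "inv_coord c \<circ> y"
  have cont: "continuous_on {u..v} y"
    using y' has_vector_derivative_continuous continuous_on_eq_continuous_within by blast
  have \<gamma>: "?\<gamma> t \<in> dom_chart c" "coord c (?\<gamma> t) = y t" if "t \<in> {u..v}" for t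
  proof -
    have "y t \<in> coord c ` (dom_chart c \<inter> UNIV)" using y that by blast
    from inv_coord_image[OF c this]
    show "?\<gamma> t \<in> dom_chart c" "coord c (?\<gamma> t) = y t" by simp_all
  qed
  have deriv: "((coord d \<circ> ?\<gamma>) has_vector_derivative dtransition c d (?\<gamma> t) (y' t)) (at t within {u..v})"
    if d: "d \<in> A" and t: "t \<in> {u..v}" and td: "?\<gamma> t \<in> dom_chart d" for d t
  proof -
    have "(transition c d has_derivative dtransition c d (?\<gamma> t)) (at (y t))"
      using has_derivative_transition[OF c d \<gamma>(1)[OF t] td] unfolding \<gamma>(2)[OF t] .
    then have "(transition c d \<circ> y has_vector_derivative dtransition c d (?\<gamma> t) (y' t))
        (at t within {u..v})"
      by (rule vector_derivative_diff_chain_within[OF y'[OF t] has_derivative_at_withinI])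
    then show ?thesis by (simp only: comp_assoc)
  qed
  have "continuous_on {t\<in>{u..v}. ?\<gamma> t \<in> dom_chart d} (\<lambda>t. dtransition c d (?\<gamma> t) (y' t))"
    if d: "d \<in> A" for d
  proof -
    have "continuous_on {t\<in>{u..v}. ?\<gamma> t \<in> dom_chart d}
        (\<lambda>t. frechet_derivative (transition c d) (at (y t)) (y' t))"
    proof (rule continuous_on_smooth_derivative[OF smooth_transition[OF c d]])
      have "y t \<in> coord c ` (dom_chart c \<inter> dom_chart d)" if "t \<in> {u..v}" "?\<gamma> t \<in> dom_chart d" for t
        using \<gamma>[OF that(1)] that(2) by (metis IntI imageI)
      then show "y ` {t\<in>{u..v}. ?\<gamma> t \<in> dom_chart d} \<subseteq> coord c ` (dom_chart c \<inter> dom_chart d)" by blast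
    qed (auto intro: continuous_on_subset[OF cont] continuous_on_subset[OF cont'])
    then show ?thesis by (rule continuous_on_eq) (use \<gamma>(2) in auto)
  qed
  moreover have "continuous_on {u..v} ?\<gamma>"
    using continuous_on_compose[OF cont continuous_on_subset[OF continuous_on_inv_coord[OF c] y]] .
  moreover have "?\<gamma> ` {u..v} \<subseteq> points A" using \<gamma>(1) c by (auto simp: points_def)
  ultimately show "C1_curve_on A u v ?\<gamma>"
    by (intro C1_curve_onI[where D = "\<lambda>d t. dtransition c d (?\<gamma> t) (y' t)"] deriv)
  show "velocity A u v ?\<gamma> t = coord_vec A c (inv_coord c (y t)) (y' t)" if t: "t \<in> {u..v}" for t
  proof
    fix d
    show "velocity A u v ?\<gamma> t d = coord_vec A c (inv_coord c (y t)) (y' t) d"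
    proof (cases "d \<in> A \<and> ?\<gamma> t \<in> dom_chart d")
      case True
      then show ?thesis using velocity_eqI[OF uv t _ _ deriv[OF _ t]] by (simp add: coord_vec_def)
    next
      case False
      then show ?thesis by (auto simp: velocity_def coord_vec_def)
    qed
  qed
qed

end

section \<open>Spacetimes in coordinates\<close>

locale lorentzian_spacetime =
  fixes A :: "('a::{t2_space,second_countable_topology}, 'e::euclidean_space) chart set"
    and g :: "('a, 'e) metric"
    and F :: "'a \<Rightarrow> ('a, 'e) tvec set"
  assumes spacetime: "spacetime A g F"
begin

sublocale atlas A
  using spacetime by unfold_locales (simp add: spacetime_def)

lemma
  assumes "p \<in> points A"
  shows bilinear_metric: "symmetric_bilinear_on (tangent_space A p) (g p)"
    and signature_metric: "lorentzian_signature (tangent_space A p) (g p)"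
  using spacetime assms by (simp_all add: spacetime_def lorentzian_metric_def)

lemma timelike_trans:
  assumes p: "p \<in> points A" and "timelike_at A g p u" "timelike_at A g p v" "timelike_at A g p w"
    and "g p u v < 0" "g p v w < 0"
  shows "g p u w < 0"
proof (rule lorentzian_timelike_trans[OF bilinear_metric[OF p] signature_metric[OF p]])
  show "\<forall>u\<in>tangent_space A p. \<forall>v\<in>tangent_space A p. \<forall>r s.
      (\<lambda>c. r *\<^sub>R u c + s *\<^sub>R v c) \<in> tangent_space A p"
    using tangent_space_closed[OF p] by simp
qed (use assms in \<open>simp_all add: timelike_at_def\<close>)

lemma metric_sym:
  assumes p: "p \<in> points A" and "u \<in> tangent_space A p" "v \<in> tangent_space A p"
  shows "g p u v = g p v u"
  using symmetric_bilinear_onD(1)[OF bilinear_metric[OF p]] assms by blast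

lemma future_cone:
  assumes p: "p \<in> points A"
  obtains u where "timelike_at A g p u" "F p = timecone A g p u"
  using spacetime p unfolding spacetime_def time_orientation_def by blast

lemma future_cone_timelike:
  assumes p: "p \<in> points A" and "u \<in> F p"
  shows "timelike_at A g p u"
  using future_cone[OF p] assms(2) unfolding timecone_def by blast

text \<open>
  By transitivity every member of a timecone selects the same timecone.
\<close>

lemma future_cone_iff:
  assumes p: "p \<in> points A" and u: "u \<in> F p" and v: "timelike_at A g p v"
  shows "v \<in> F p \<longleftrightarrow> g p u v < 0"
proof -
  obtain u0 where u0: "timelike_at A g p u0" "F p = timecone A g p u0"
    by (rule future_cone[OF p])
  have ut: "timelike_at A g p u" "g p u0 u < 0" using u u0(2) by (simp_all add: timecone_def)
  have "g p u u0 < 0" using metric_sym[OF p, of u u0] ut u0(1) by (simp add: timelike_at_def)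
  then have "g p u0 v < 0 \<longleftrightarrow> g p u v < 0"
    using timelike_trans[OF p u0(1) ut(1) v ut(2)] timelike_trans[OF p ut(1) u0(1) v] by blast
  then show ?thesis using u0(2) v by (simp add: timecone_def)
qed

lemma future_timelike_subset_nonspacelike:
  assumes p: "p \<in> points A"
  shows "future_timelike A g F p \<subseteq> future_nonspacelike A g F p"
proof
  fix v assume "v \<in> future_timelike A g F p"
  then have v: "timelike_at A g p v" "v \<in> F p" by (simp_all add: future_timelike_def)
  have vT: "v \<in> tangent_space A p" "g p v v < 0" using v(1) by (simp_all add: timelike_at_def)
  have "g p (\<lambda>c. 0 *\<^sub>R v c + 0 *\<^sub>R v c) v = 0 * g p v v + 0 * g p v v"
    by (rule symmetric_bilinear_onD(2)[OF bilinear_metric[OF p] vT(1) vT(1) vT(1)])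
  then have "v \<noteq> (\<lambda>_. 0)" using vT(2) by auto
  moreover have "\<forall>u\<in>F p. g p u v < 0" using future_cone_iff[OF p _ v(1)] v(2) by blast
  ultimately show "v \<in> future_nonspacelike A g F p"
    using vT by (simp add: future_nonspacelike_def nonspacelike_at_def)
qed

text \<open>
  The metric in the coordinates of a chart. Unlike the metric itself it acts on a vector space that
  does not depend on the point, so that values at different points can be compared.
\<close>

definition form :: "('a, 'e) chart \<Rightarrow> 'e \<Rightarrow> 'e \<Rightarrow> 'e \<Rightarrow> real" where
  "form c x a b = g (inv_coord c x) (coord_vec A c (inv_coord c x) a) (coord_vec A c (inv_coord c x) b)"

lemma inv_coord_in_points:
  assumes "c \<in> A" "x \<in> coord c ` dom_chart c"
  shows "inv_coord c x \<in> dom_chart c" "inv_coord c x \<in> points A"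
  using inv_coord_image(1)[of c x UNIV] assms by (auto simp: points_def)

lemma form_coord:
  assumes c: "c \<in> A" and p: "p \<in> dom_chart c"
    and u: "u \<in> tangent_space A p" and v: "v \<in> tangent_space A p"
  shows "form c (coord c p) (u c) (v c) = g p u v"
  unfolding form_def inv_coord_coord[OF c p]
  using tangent_eq_coord_vec[OF c p u] tangent_eq_coord_vec[OF c p v] by simp

lemma form_sym:
  assumes c: "c \<in> A" and x: "x \<in> coord c ` dom_chart c"
  shows "form c x a b = form c x b a"
  unfolding form_def
  using inv_coord_in_points[OF c x] coord_vec_in_tangent_space[OF c] by (intro metric_sym)

lemma bilinear_form:
  assumes c: "c \<in> A" and x: "x \<in> coord c ` dom_chart c"
  shows "bilinear (form c x)"
proof -
  note p = inv_coord_in_points[OF c x]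
  have comb: "form c x (r *\<^sub>R a + s *\<^sub>R b) d = r * form c x a d + s * form c x b d" for r s a b d
    unfolding form_def coord_vec_linear[OF c p(1)]
    by (rule symmetric_bilinear_onD(2)[OF bilinear_metric[OF p(2)]])
      (rule coord_vec_in_tangent_space[OF c p(1)])+
  have lin: "linear (\<lambda>a. form c x a d)" for d
  proof (rule linearI)
    show "form c x (a + b) d = form c x a d + form c x b d" for a b
      using comb[of 1 a 1 b d] by simp
    show "form c x (r *\<^sub>R a) d = r *\<^sub>R form c x a d" for r a
      using comb[of r a 0 a d] by simp
  qed
  have eq: "form c x a = (\<lambda>b. form c x b a)" for a using form_sym[OF c x] by (intro ext)
  have "linear (form c x a)" for a by (subst eq) (rule lin)
  then show ?thesis using lin by (simp add: bilinear_def)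
qed

lemma lipschitz_form:
  assumes c: "c \<in> A" and p: "p \<in> dom_chart c"
  obtains r L where "r > 0" "ball (coord c p) r \<subseteq> coord c ` dom_chart c"
    "lipschitz_forms (ball (coord c p) r) (form c) L"
proof -
  let ?U = "coord c ` dom_chart c" and ?x = "coord c p"
  obtain r where r: "r > 0" "cball ?x r \<subseteq> ?U"
    using open_contains_cball[THEN iffD1, OF open_coord_image_dom[OF c], rule_format, OF imageI[OF p]]
    by (elim exE conjE) (rule that)
  define P where "P i j L \<longleftrightarrow> 0 \<le> L \<and>
    (\<forall>y\<in>cball ?x r. \<forall>z\<in>cball ?x r. \<bar>form c y i j - form c z i j\<bar> \<le> L * norm (y - z))" for i j L
  have "\<exists>L. P i j L" if "i \<in> Basis" "j \<in> Basis" for i j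
  proof -
    have "smooth_on ?U (\<lambda>y. form c y i j)"
      using spacetime c that by (simp add: spacetime_def lorentzian_metric_def form_def)
    then show ?thesis unfolding P_def by (rule smooth_on_lipschitz_cball[OF _ r(2)])
  qed
  then obtain L where L: "\<And>i j. i \<in> Basis \<Longrightarrow> j \<in> Basis \<Longrightarrow> P i j (L i j)" by metis
  let ?L = "\<Sum>i\<in>Basis. \<Sum>j\<in>Basis. L i j"
  have "lipschitz_forms (ball ?x r) (form c) ?L"
  proof
    fix y a b assume y: "y \<in> ball ?x r"
    then have yU: "y \<in> ?U" using r(2) by auto
    show "bilinear (form c y)" by (rule bilinear_form[OF c yU])
    show "form c y a b = form c y b a" by (rule form_sym[OF c yU])
    fix z assume z: "z \<in> ball ?x r"
    then have zU: "z \<in> ?U" using r(2) by auto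
    have diff: "form c y a b - form c z a b
        = (\<Sum>i\<in>Basis. \<Sum>j\<in>Basis. (a \<bullet> i) * (b \<bullet> j) * (form c y i j - form c z i j))"
      unfolding bilinear_eq_sum_Basis[OF bilinear_form[OF c yU], of a b]
        bilinear_eq_sum_Basis[OF bilinear_form[OF c zU], of a b]
      by (simp add: right_diff_distrib sum_subtractf)
    have "\<bar>form c y a b - form c z a b\<bar> \<le> (\<Sum>i\<in>Basis. \<Sum>j\<in>Basis. \<bar>(a \<bullet> i) * (b \<bullet> j) * (form c y i j - form c z i j)\<bar>)"
      unfolding diff by (rule order_trans[OF sum_abs], rule sum_mono, rule sum_abs)
    also have "\<dots> \<le> (\<Sum>i\<in>Basis. \<Sum>j\<in>Basis. (norm a * norm b) * (L i j * norm (y - z)))"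
    proof (intro sum_mono)
      fix i j :: 'e assume ij: "i \<in> Basis" "j \<in> Basis"
      have "\<bar>form c y i j - form c z i j\<bar> \<le> L i j * norm (y - z)"
        using L[OF ij] y z by (simp add: P_def)
      moreover have "\<bar>(a \<bullet> i) * (b \<bullet> j)\<bar> \<le> norm a * norm b"
        unfolding abs_mult using Basis_le_norm ij by (intro mult_mono) auto
      ultimately show "\<bar>(a \<bullet> i) * (b \<bullet> j) * (form c y i j - form c z i j)\<bar>
          \<le> (norm a * norm b) * (L i j * norm (y - z))"
        unfolding abs_mult[of "(a \<bullet> i) * (b \<bullet> j)"] by (intro mult_mono) auto
    qed
    also have "\<dots> = ?L * norm (y - z) * norm a * norm b"
      by (simp add: sum_distrib_left sum_distrib_right mult_ac)
    finally show "\<bar>form c y a b - form c z a b\<bar> \<le> ?L * norm (y - z) * norm a * norm b" .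
  next
    show "0 \<le> ?L" using L by (intro sum_nonneg) (simp add: P_def)
  qed simp
  moreover have "ball ?x r \<subseteq> ?U" using r(2) ball_subset_cball by blast
  ultimately show ?thesis using that r(1) by blast
qed

text \<open>
  A time orientation only provides a continuous future vector field \<^term>\<open>V\<close>. The vector \<^term>\<open>w\<close> with
  the constant components of \<^term>\<open>V p\<close> is timelike and has negative product with \<^term>\<open>V\<close> at \<^term>\<open>p\<close>, and
  by continuity also at all points near \<^term>\<open>p\<close>; hence it lies in the same cone as \<^term>\<open>V\<close>. A constant
  vector can be added to the velocity of a curve by adding a multiple of it to the curve.
\<close>

lemma constant_future_vector:
  assumes p: "p \<in> points A" and S: "open S" "p \<in> S"
  obtains c B w L where "c \<in> A" "p \<in> dom_chart c" "coord c p \<in> B"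
    "B \<subseteq> coord c ` (dom_chart c \<inter> S)" "lipschitz_forms B (form c) L"
    "\<forall>x\<in>B. coord_vec A c (inv_coord c x) w \<in> F (inv_coord c x)" "\<forall>x\<in>B. form c x w w < 0"
proof -
  obtain c where c: "c \<in> A" "p \<in> dom_chart c" using p by (auto simp: points_def)
  obtain W V where W: "open W" "p \<in> W" "W \<subseteq> points A"
    and V: "continuous_vector_field_on A W V" and VF: "\<forall>q\<in>W. V q \<in> F q"
    using spacetime p unfolding spacetime_def time_orientation_def by blast
  obtain r L where r: "r > 0" "ball (coord c p) r \<subseteq> coord c ` dom_chart c"
    and L: "lipschitz_forms (ball (coord c p) r) (form c) L"
    by (rule lipschitz_form[OF c])
  interpret lipschitz_forms "ball (coord c p) r" "form c" L by (rule L)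
  define w where "w = V p c"
  define X where "X = ball (coord c p) r \<inter> coord c ` (dom_chart c \<inter> (W \<inter> S))"
  define v where "v x = V (inv_coord c x) c" for x
  have "open X"
    unfolding X_def by (intro open_Int open_ball open_coord_image c W S)
  then have X: "open X" "X \<subseteq> ball (coord c p) r" "X \<subseteq> coord c ` dom_chart c"
    "X \<subseteq> coord c ` (dom_chart c \<inter> (W \<inter> S))"
    by (auto simp: X_def)
  have pX: "coord c p \<in> X" unfolding X_def using r c W S by auto
  have XW: "inv_coord c x \<in> dom_chart c" "inv_coord c x \<in> W" "coord c (inv_coord c x) = x"
    if "x \<in> X" for x
    using inv_coord_image[OF c(1), of x "W \<inter> S"] X(4) that by blast+
  have contv: "continuous_on X v"
  proof -
    have "continuous_on (W \<inter> dom_chart c) (\<lambda>q. V q c)"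
      using V c(1) unfolding continuous_vector_field_on_def by blast
    moreover have "continuous_on X (inv_coord c)"
      by (rule continuous_on_subset[OF continuous_on_inv_coord[OF c(1)] X(3)])
    moreover have "inv_coord c ` X \<subseteq> W \<inter> dom_chart c" using XW by blast
    ultimately show ?thesis unfolding v_def by (rule continuous_on_compose2)
  qed
  have c1: "continuous_on X (\<lambda>x. form c x (v x) w)" and c2: "continuous_on X (\<lambda>x. form c x w w)"
    by (intro continuous_on_form continuous_intros contv; use X(2) in auto)+
  define B where "B = (X \<inter> (\<lambda>x. form c x (v x) w) -` {..<0}) \<inter> (X \<inter> (\<lambda>x. form c x w w) -` {..<0})"
  have "open B"
    unfolding B_def by (intro open_Int continuous_open_preimage c1 c2 X(1) open_lessThan)
  have BX: "B \<subseteq> X" by (auto simp: B_def)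
  have "lipschitz_forms B (form c) L"
  proof
    show "open B" by fact
    show "0 \<le> L" by (rule L_nonneg)
    fix y a b assume "y \<in> B"
    then have y: "y \<in> ball (coord c p) r" using BX X(2) by blast
    show "bilinear (form c y)" by (rule bilinear[OF y])
    show "form c y a b = form c y b a" by (rule sym[OF y])
    fix z assume "z \<in> B"
    then have z: "z \<in> ball (coord c p) r" using BX X(2) by blast
    show "\<bar>form c y a b - form c z a b\<bar> \<le> L * norm (y - z) * norm a * norm b"
      by (rule lipschitz[OF y z])
  qed
  moreover have "coord c p \<in> B"
  proof -
    have "timelike_at A g p (V p)" using future_cone_timelike[OF p] VF W(2) by blast
    then have "form c (coord c p) w w < 0"
      unfolding w_def using form_coord[OF c] by (simp add: timelike_at_def)
    moreover have "v (coord c p) = w" by (simp add: v_def w_def inv_coord_coord[OF c])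
    ultimately show ?thesis using pX by (simp add: B_def)
  qed
  moreover have "\<forall>x\<in>B. coord_vec A c (inv_coord c x) w \<in> F (inv_coord c x)"
  proof
    fix x assume x: "x \<in> B"
    let ?q = "inv_coord c x"
    note q = XW[OF subsetD[OF BX x]]
    have qA: "?q \<in> points A" using W(3) q(2) by blast
    have VT: "V ?q \<in> tangent_space A ?q" using V q(2) unfolding continuous_vector_field_on_def by blast
    have "timelike_at A g ?q (coord_vec A c ?q w)"
      using x coord_vec_in_tangent_space[OF c(1) q(1)] by (simp add: B_def form_def timelike_at_def)
    moreover have "g ?q (V ?q) (coord_vec A c ?q w) < 0"
      using x tangent_eq_coord_vec[OF c(1) q(1) VT] by (simp add: B_def form_def v_def)
    ultimately show "coord_vec A c ?q w \<in> F ?q"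
      using future_cone_iff[OF qA, of "V ?q"] VF q(2) by blast
  qed
  moreover have "\<forall>x\<in>B. form c x w w < 0" by (simp add: B_def)
  moreover have "B \<subseteq> coord c ` (dom_chart c \<inter> S)" using BX X(4) by blast
  ultimately show ?thesis by (intro that[OF c])
qed

section \<open>Chronological and causal futures of open sets\<close>

text \<open>
  A vector is future timelike if it is timelike and has negative product with one future timelike
  vector, here \<^term>\<open>w\<close>. So two inequalities for real functions of the coordinates suffice to
  construct a future timelike curve.
\<close>

lemma chron_precedes_lift:
  assumes c: "c \<in> A" and ab: "a < b" and B: "B \<subseteq> coord c ` dom_chart c"
    and w: "\<forall>x\<in>B. coord_vec A c (inv_coord c x) w \<in> F (inv_coord c x)"
    and y: "y ` {a..b} \<subseteq> B"
    and y': "\<And>t. t \<in> {a..b} \<Longrightarrow> (y has_vector_derivative y' t) (at t within {a..b})"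
    and cont': "continuous_on {a..b} y'"
    and timelike: "\<And>t. t \<in> {a..b} \<Longrightarrow> form c (y t) (y' t) (y' t) < 0"
    and future: "\<And>t. t \<in> {a..b} \<Longrightarrow> form c (y t) w (y' t) < 0"
  shows "chron_precedes A g F (inv_coord c (y a)) (inv_coord c (y b))"
proof -
  have "coord_vec A c (inv_coord c (y t)) (y' t) \<in> future_timelike A g F (inv_coord c (y t))"
    if t: "t \<in> {a..b}" for t
  proof -
    let ?q = "inv_coord c (y t)"
    have yt: "y t \<in> B" "y t \<in> coord c ` dom_chart c" using y B t by blast+
    note q = inv_coord_in_points[OF c yt(2)]
    have v: "timelike_at A g ?q (coord_vec A c ?q (y' t))"
      using coord_vec_in_tangent_space[OF c q(1)] timelike[OF t]
      by (simp add: timelike_at_def form_def)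
    have "coord_vec A c ?q w \<in> F ?q" using w yt(1) by blast
    moreover have "g ?q (coord_vec A c ?q w) (coord_vec A c ?q (y' t)) < 0"
      using future[OF t] by (simp add: form_def)
    ultimately have "coord_vec A c ?q (y' t) \<in> F ?q" using future_cone_iff[OF q(2) _ v] by blast
    then show ?thesis using v by (simp add: future_timelike_def)
  qed
  note K = this
  have "piecewise_C1_curve_in A (future_timelike A g F) a b (inv_coord c \<circ> y)"
  proof (rule piecewise_C1_curve_inI[OF ab finite.emptyI])
    fix u v assume uv: "a \<le> u" "u < v" "v \<le> b"
    then have sub: "{u..v} \<subseteq> {a..b}" by auto
    have yc: "y ` {u..v} \<subseteq> coord c ` dom_chart c" using y B sub by blast
    have deriv: "(y has_vector_derivative y' t) (at t within {u..v})" if "t \<in> {u..v}" for t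
      using has_vector_derivative_within_subset[OF y' sub] sub that by blast
    note curve = C1_curve_on_inv_coord[OF c uv(2) yc deriv continuous_on_subset[OF cont' sub]]
    have "velocity A u v (inv_coord c \<circ> y) t \<in> future_timelike A g F ((inv_coord c \<circ> y) t)"
      if t: "t \<in> {u..v}" for t
      unfolding curve(2)[OF _ t, simplified] comp_apply using K sub t by blast
    then show "C1_curve_on A u v (inv_coord c \<circ> y) \<and> (\<forall>t\<in>{u..v}.
        velocity A u v (inv_coord c \<circ> y) t \<in> future_timelike A g F ((inv_coord c \<circ> y) t))"
      using curve(1) by blast
  qed
  moreover have "(inv_coord c \<circ> y) a = inv_coord c (y a)" "(inv_coord c \<circ> y) b = inv_coord c (y b)"
    by simp_all
  ultimately show ?thesis unfolding chron_precedes_def by (intro exI conjI)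
qed

lemma chron_precedes_trans:
  assumes "chron_precedes A g F p q" "chron_precedes A g F q r"
  shows "chron_precedes A g F p r"
proof -
  let ?K = "future_timelike A g F"
  obtain \<gamma> a b where \<gamma>: "piecewise_C1_curve_in A ?K a b \<gamma>" "\<gamma> a = p" "\<gamma> b = q"
    using assms(1) unfolding chron_precedes_def by (elim exE conjE) (rule that)
  obtain \<delta> b' c' where \<delta>: "piecewise_C1_curve_in A ?K b' c' \<delta>" "\<delta> b' = q" "\<delta> c' = r"
    using assms(2) unfolding chron_precedes_def by (elim exE conjE) (rule that)
  have ab: "a < b" "b' < c'" using \<gamma>(1) \<delta>(1) by (simp_all add: piecewise_C1_curve_in_def)
  \<comment> \<open>The second curve is shifted to start at the parameter \<^term>\<open>b\<close>.\<close>
  define h c where "h = b' - b" and "c = c' - h"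
  have "b < c" using ab by (simp add: h_def c_def)
  moreover have "(\<lambda>t. 1 * t + h) ` {b..c} = {b'..c'}"
    unfolding image_affinity_atLeastAtMost using ab by (simp add: h_def c_def)
  ultimately have "piecewise_C1_curve_in A ?K b c (\<delta> \<circ> (\<lambda>t. 1 * t + h))"
    by (intro piecewise_C1_curve_in_affine[OF \<delta>(1)]) simp_all
  from piecewise_C1_curve_in_join[OF \<gamma>(1) this]
  have "piecewise_C1_curve_in A ?K a c (\<lambda>t. if t \<le> b then \<gamma> t else (\<delta> \<circ> (\<lambda>t. 1 * t + h)) t)"
    using \<gamma> \<delta> by (simp add: h_def)
  then show ?thesis unfolding chron_precedes_def using \<gamma> \<delta> ab \<open>b < c\<close>
    by (intro exI conjI) (assumption, simp_all add: c_def)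
qed

text \<open>
  In a chart around a point \<^term>\<open>p\<close> of \<^term>\<open>S\<close>, a short straight segment in a constant future timelike
  direction ends at \<^term>\<open>p\<close> and starts in \<^term>\<open>S\<close>.
\<close>

lemma open_subset_I_plus:
  assumes S: "open S" "S \<subseteq> points A"
  shows "S \<subseteq> I_plus A g F S"
proof
  fix p assume p: "p \<in> S"
  then have pA: "p \<in> points A" using S by blast
  obtain c B w L where c: "c \<in> A" "p \<in> dom_chart c" and pB: "coord c p \<in> B"
    and B: "B \<subseteq> coord c ` (dom_chart c \<inter> S)" and L: "lipschitz_forms B (form c) L"
    and w: "\<forall>x\<in>B. coord_vec A c (inv_coord c x) w \<in> F (inv_coord c x)"
    and neg: "\<forall>x\<in>B. form c x w w < 0"
    by (rule constant_future_vector[OF pA S(1) p])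
  interpret lipschitz_forms B "form c" L by (rule L)
  obtain e where e: "e > 0" "ball (coord c p) e \<subseteq> B"
    using openE[OF open_B pB] .
  define h where "h = e / (2 * (norm w + 1))"
  have h: "h > 0" unfolding h_def using e by (simp add: add_nonneg_pos)
  have "h * norm w < e"
  proof -
    have "h * norm w \<le> h * (norm w + 1)" using h by simp
    also have "\<dots> = e / 2" unfolding h_def using norm_ge_zero[of w]
      by (simp add: field_simps add_nonneg_eq_0_iff)
    finally show ?thesis using e(1) by linarith
  qed
  define y where "y t = coord c p + t *\<^sub>R w" for t
  have yB: "y ` {- h..0} \<subseteq> B"
  proof -
    have "y t \<in> ball (coord c p) e" if "t \<in> {- h..0}" for t
    proof -
      have "\<bar>t\<bar> * norm w \<le> h * norm w" using that by (intro mult_right_mono) auto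
      then show ?thesis using \<open>h * norm w < e\<close> by (simp add: y_def dist_norm)
    qed
    then show ?thesis using e(2) by blast
  qed
  have Bc: "B \<subseteq> coord c ` dom_chart c" using B by blast
  have "chron_precedes A g F (inv_coord c (y (- h))) (inv_coord c (y 0))"
  proof (rule chron_precedes_lift[OF c(1) _ Bc w yB])
    fix t assume "t \<in> {- h..0}"
    then have "y t \<in> B" using yB by blast
    then show "form c (y t) w w < 0" "form c (y t) w w < 0" using neg by blast+
    show "(y has_vector_derivative w) (at t within {- h..0})"
      unfolding y_def by (auto intro!: derivative_eq_intros)
  qed (use h in \<open>auto intro: continuous_intros\<close>)
  moreover have "inv_coord c (y 0) = p" using inv_coord_coord[OF c] by (simp add: y_def)
  moreover have "inv_coord c (y (- h)) \<in> S"
  proof -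
    have "- h \<in> {- h..0}" using h by simp
    then have "y (- h) \<in> coord c ` (dom_chart c \<inter> S)" using yB B by blast
    then show ?thesis by (rule inv_coord_image(2)[OF c(1)])
  qed
  ultimately show "p \<in> I_plus A g F S" using pA by (auto simp: I_plus_def I_plus_pt_def)
qed

text \<open>
  The local step of the main argument. Every point near the end of a short causal curve is reached
  by a timelike curve that starts near its beginning. If the beginning is in the interior of
  \<^term>\<open>T\<close>, the timelike curve starts in \<^term>\<open>T\<close>, so a whole neighbourhood of the end belongs to
  \<^term>\<open>T\<close>. The property that is carried along the curve has to concern the interior of \<^term>\<open>T\<close>, because
  the perturbed curve does not start at the given point.
\<close>

lemma interior_future_set_local:
  assumes p: "p \<in> points A"
    and future_set: "\<And>s t. s \<in> T \<Longrightarrow> chron_precedes A g F s t \<Longrightarrow> t \<in> points A \<Longrightarrow> t \<in> T"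
  shows "\<exists>N. open N \<and> p \<in> N \<and> (\<forall>u v. u < v \<and> C1_curve_on A u v \<gamma> \<and>
    (\<forall>t\<in>{u..v}. velocity A u v \<gamma> t \<in> future_nonspacelike A g F (\<gamma> t)) \<and>
    \<gamma> ` {u..v} \<subseteq> N \<and> \<gamma> u \<in> interior T \<longrightarrow> \<gamma> v \<in> interior T)"
proof -
  obtain c B w L where c: "c \<in> A" "p \<in> dom_chart c" and pB: "coord c p \<in> B"
    and B: "B \<subseteq> coord c ` (dom_chart c \<inter> UNIV)" and L: "lipschitz_forms B (form c) L"
    and w: "\<forall>x\<in>B. coord_vec A c (inv_coord c x) w \<in> F (inv_coord c x)"
    and neg: "\<forall>x\<in>B. form c x w w < 0"
    by (rule constant_future_vector[OF p open_UNIV UNIV_I])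
  interpret lipschitz_forms B "form c" L by (rule L)
  have Bc: "B \<subseteq> coord c ` dom_chart c" using B by blast
  define N where "N = inv_coord c ` B"
  have "open N" unfolding N_def by (rule open_inv_coord_image[OF c(1) open_B Bc])
  moreover have "p \<in> N" unfolding N_def using inv_coord_coord[OF c] pB by (metis imageI)
  moreover have "\<forall>u v. u < v \<and> C1_curve_on A u v \<gamma> \<and>
    (\<forall>t\<in>{u..v}. velocity A u v \<gamma> t \<in> future_nonspacelike A g F (\<gamma> t)) \<and>
    \<gamma> ` {u..v} \<subseteq> N \<and> \<gamma> u \<in> interior T \<longrightarrow> \<gamma> v \<in> interior T"
  proof (intro allI impI, elim conjE)
    fix u v
    assume uv: "u < v" and \<gamma>: "C1_curve_on A u v \<gamma>"
      and K: "\<forall>t\<in>{u..v}. velocity A u v \<gamma> t \<in> future_nonspacelike A g F (\<gamma> t)"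
      and \<gamma>N: "\<gamma> ` {u..v} \<subseteq> N" and start: "\<gamma> u \<in> interior T"
    define x where "x = coord c \<circ> \<gamma>"
    define x' where "x' t = velocity A u v \<gamma> t c" for t
    have \<gamma>x: "x t \<in> B" "\<gamma> t \<in> dom_chart c" "inv_coord c (x t) = \<gamma> t" if t: "t \<in> {u..v}" for t
    proof -
      obtain b where b: "b \<in> B" "\<gamma> t = inv_coord c b" using \<gamma>N t unfolding N_def by blast
      have "b \<in> coord c ` (dom_chart c \<inter> UNIV)" using b(1) B by blast
      from inv_coord_image[OF c(1) this] b
      show "x t \<in> B" "\<gamma> t \<in> dom_chart c" "inv_coord c (x t) = \<gamma> t" by (simp_all add: x_def)
    qed
    have xB: "x ` {u..v} \<subseteq> B" using \<gamma>x(1) by blast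
    have deriv: "(x has_vector_derivative x' t) (at t within {u..v})" if t: "t \<in> {u..v}" for t
      unfolding x_def x'_def by (rule C1_curve_on_chart(1)[OF \<gamma> uv c(1) t \<gamma>x(2)[OF t]])
    have "{t\<in>{u..v}. \<gamma> t \<in> dom_chart c} = {u..v}" using \<gamma>x(2) by blast
    then have cont: "continuous_on {u..v} x'"
      unfolding x'_def using C1_curve_on_chart(2)[OF \<gamma> uv c(1)] by simp
    have nonspacelike: "form c (x t) (x' t) (x' t) \<le> 0" "form c (x t) w (x' t) < 0"
      if t: "t \<in> {u..v}" for t
    proof -
      let ?v = "velocity A u v \<gamma> t" and ?w = "coord_vec A c (\<gamma> t) w"
      have v: "?v \<in> tangent_space A (\<gamma> t)" "g (\<gamma> t) ?v ?v \<le> 0" "\<forall>u\<in>F (\<gamma> t). g (\<gamma> t) u ?v < 0"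
        using K[rule_format, OF t] by (simp_all add: future_nonspacelike_def nonspacelike_at_def)
      have wF: "?w \<in> F (\<gamma> t)" using w[rule_format, OF \<gamma>x(1)[OF t]] unfolding \<gamma>x(3)[OF t] .
      note dom = c(1) \<gamma>x(2)[OF t]
      show "form c (x t) (x' t) (x' t) \<le> 0"
        unfolding x_def x'_def comp_apply form_coord[OF dom v(1) v(1)] by (rule v(2))
      have "form c (x t) (?w c) (x' t) = g (\<gamma> t) ?w ?v"
        unfolding x_def x'_def comp_apply
        by (rule form_coord[OF dom coord_vec_in_tangent_space[OF dom] v(1)])
      then show "form c (x t) w (x' t) < 0" using v(3) wF coord_vec_self[OF dom] by simp
    qed
    have endpoints: "u \<in> {u..v}" "v \<in> {u..v}" using uv by simp_all
    let ?O = "coord c ` (dom_chart c \<inter> interior T)"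
    have "x u \<in> ?O" unfolding x_def using \<gamma>x(2)[OF endpoints(1)] start by simp
    then obtain e where e: "e > 0" "ball (x u) e \<subseteq> ?O"
      using openE[OF open_coord_image[OF c(1) open_interior]] by blast
    obtain \<delta> where \<delta>: "\<delta> > 0" and nearby: "\<forall>z. dist z (x v) < \<delta> \<longrightarrow> (\<exists>y y'. y ` {u..v} \<subseteq> B \<and>
       (\<forall>t\<in>{u..v}. (y has_vector_derivative y' t) (at t within {u..v}) \<and>
          form c (y t) (y' t) (y' t) < 0 \<and> form c (y t) w (y' t) < 0) \<and>
       continuous_on {u..v} y' \<and> dist (y u) (x u) < e \<and> y v = z)"
    proof (rule exE)
      show "\<exists>\<delta>>0. \<forall>z. dist z (x v) < \<delta> \<longrightarrow> (\<exists>y y'. y ` {u..v} \<subseteq> B \<and>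
         (\<forall>t\<in>{u..v}. (y has_vector_derivative y' t) (at t within {u..v}) \<and>
            form c (y t) (y' t) (y' t) < 0 \<and> form c (y t) w (y' t) < 0) \<and>
         continuous_on {u..v} y' \<and> dist (y u) (x u) < e \<and> y v = z)"
        by (rule negative_curves_to_nearby_points[OF uv _ xB _ cont _ _ e(1)])
          (fact neg[rule_format] deriv nonspacelike)+
    qed (elim conjE, rule that)
    have "inv_coord c z \<in> T" if z: "z \<in> B \<inter> ball (x v) \<delta>" for z
    proof -
      have "dist z (x v) < \<delta>" using z by (simp add: dist_commute)
      from nearby[rule_format, OF this] obtain y y' where y: "y ` {u..v} \<subseteq> B"
        and y': "\<forall>t\<in>{u..v}. (y has_vector_derivative y' t) (at t within {u..v}) \<and>
          form c (y t) (y' t) (y' t) < 0 \<and> form c (y t) w (y' t) < 0"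
        and y'_cont: "continuous_on {u..v} y'" and yu: "dist (y u) (x u) < e" and yv: "y v = z"
        by (elim exE conjE) (rule that)
      have "chron_precedes A g F (inv_coord c (y u)) (inv_coord c (y v))"
        by (rule chron_precedes_lift[OF c(1) uv Bc w y _ y'_cont]) (use y' in simp_all)
      moreover have "inv_coord c (y u) \<in> T"
      proof -
        have "y u \<in> ?O" using e(2) yu by (auto simp: dist_commute)
        from inv_coord_image(2)[OF c(1) this] show ?thesis using interior_subset by blast
      qed
      moreover have "inv_coord c (y v) \<in> points A"
        using inv_coord_in_points(2)[OF c(1)] Bc z yv by blast
      ultimately show ?thesis using future_set yv by blast
    qed
    then have "inv_coord c ` (B \<inter> ball (x v) \<delta>) \<subseteq> T" by blast
    moreover have "open (inv_coord c ` (B \<inter> ball (x v) \<delta>))"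
      using open_B Bc by (intro open_inv_coord_image[OF c(1)]) auto
    moreover have "\<gamma> v \<in> inv_coord c ` (B \<inter> ball (x v) \<delta>)"
      using \<gamma>x(1,3)[OF endpoints(2)] \<delta> by (intro image_eqI[of _ _ "x v"]) auto
    ultimately show "\<gamma> v \<in> interior T" by (intro interiorI)
  qed
  ultimately show ?thesis by (intro exI[of _ N] conjI)
qed

text \<open>
  \<^term>\<open>I_plus A g F S\<close> is a future set, since chronological precedence is transitive, and \<^term>\<open>S\<close> lies in
  its interior because \<^term>\<open>S\<close> is open. So causal curves that start in \<^term>\<open>S\<close> never leave it.
\<close>

lemma J_plus_open_subset_I_plus:
  assumes S: "open S" "S \<subseteq> points A"
  shows "J_plus A g F S \<subseteq> I_plus A g F S"
proof
  fix q assume "q \<in> J_plus A g F S"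
  then obtain s where s: "s \<in> S" "q \<in> points A" "causal_precedes A g F s q"
    by (auto simp: J_plus_def J_plus_pt_def)
  show "q \<in> I_plus A g F S"
  proof (cases "s = q")
    case True
    then show ?thesis using open_subset_I_plus[OF S] s(1) by blast
  next
    case False
    then have "\<exists>\<gamma> a b. piecewise_C1_curve_in A (future_nonspacelike A g F) a b \<gamma> \<and> \<gamma> a = s \<and> \<gamma> b = q"
      using s(3) unfolding causal_precedes_def by simp
    then obtain \<gamma> a b where \<gamma>: "piecewise_C1_curve_in A (future_nonspacelike A g F) a b \<gamma>"
      and ends: "\<gamma> a = s" "\<gamma> b = q"
      by (elim exE conjE) (rule that)
    have "\<gamma> b \<in> interior (I_plus A g F S)"
    proof (rule piecewise_C1_curve_induct[OF \<gamma>, where Q = "\<lambda>p. p \<in> interior (I_plus A g F S)"])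
      show "\<gamma> a \<in> interior (I_plus A g F S)"
        using interior_maximal[OF open_subset_I_plus[OF S] S(1)] s(1) ends(1) by blast
      fix p assume "p \<in> points A"
      then show "\<exists>N. open N \<and> p \<in> N \<and> (\<forall>u v. u < v \<and> C1_curve_on A u v \<gamma> \<and>
          (\<forall>t\<in>{u..v}. velocity A u v \<gamma> t \<in> future_nonspacelike A g F (\<gamma> t)) \<and>
          \<gamma> ` {u..v} \<subseteq> N \<and> \<gamma> u \<in> interior (I_plus A g F S) \<longrightarrow> \<gamma> v \<in> interior (I_plus A g F S))"
      proof (rule interior_future_set_local)
        fix r t assume "r \<in> I_plus A g F S" "chron_precedes A g F r t" "t \<in> points A"
        then show "t \<in> I_plus A g F S"
          unfolding I_plus_def I_plus_pt_def using chron_precedes_trans by blast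
      qed
    qed
    then show ?thesis using interior_subset ends(2) by blast
  qed
qed

lemma I_plus_subset_J_plus: "I_plus A g F S \<subseteq> J_plus A g F S"
proof -
  have "causal_precedes A g F p q" if pq: "chron_precedes A g F p q" for p q
  proof -
    obtain \<gamma> a b where \<gamma>: "piecewise_C1_curve_in A (future_timelike A g F) a b \<gamma>" "\<gamma> a = p" "\<gamma> b = q"
      using pq unfolding chron_precedes_def by (elim exE conjE) (rule that)
    have "piecewise_C1_curve_in A (future_nonspacelike A g F) a b \<gamma>"
      by (rule piecewise_C1_curve_in_mono[OF \<gamma>(1) future_timelike_subset_nonspacelike])
    then show ?thesis unfolding causal_precedes_def using \<gamma>(2,3) by (intro disjI2 exI conjI)
  qed
  then show ?thesis by (auto simp: I_plus_def J_plus_def I_plus_pt_def J_plus_pt_def)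
qed

end

section \<open>Time reversal\<close>

text \<open>
  Reversing all cones exchanges future and past, so that every statement about futures has a dual
  statement about pasts. The operation is also applied to the sets of admissible velocities.
\<close>

definition reverse_cones :: "('a \<Rightarrow> ('a, 'e::euclidean_space) tvec set) \<Rightarrow> 'a \<Rightarrow> ('a, 'e) tvec set" where
  "reverse_cones K p = {v. (\<lambda>c. - v c) \<in> K p}"

lemma reverse_cones_reverse_cones [simp]: "reverse_cones (reverse_cones K) = K"
  by (auto simp: reverse_cones_def)

lemma piecewise_C1_curve_in_reverse:
  assumes "piecewise_C1_curve_in A K a b \<gamma>"
  shows "piecewise_C1_curve_in A (reverse_cones K) (- b) (- a) (\<gamma> \<circ> uminus)"
proof -
  have ab: "a < b" using assms by (simp add: piecewise_C1_curve_in_def)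
  have "piecewise_C1_curve_in A (reverse_cones K) (- b) (- a) (\<gamma> \<circ> (\<lambda>t. - 1 * t + 0))"
  proof (rule piecewise_C1_curve_in_affine[OF assms])
    show "(\<lambda>t. - 1 * t + 0) ` {- b..- a} = {a..b}"
      unfolding image_affinity_atLeastAtMost using ab by simp
  qed (use ab in \<open>simp_all add: reverse_cones_def\<close>)
  moreover have "(\<lambda>t::real. - 1 * t + 0) = uminus" by auto
  ultimately show ?thesis by simp
qed

context lorentzian_spacetime
begin

lemma tangent_space_uminus:
  assumes "p \<in> points A"
  shows "(\<lambda>c. - v c) \<in> tangent_space A p \<longleftrightarrow> v \<in> tangent_space A p"
proof -
  have "(\<lambda>c. - v c) \<in> tangent_space A p" if "v \<in> tangent_space A p" for v
    using tangent_space_closed[OF assms that that, of "- 1" 0] by simp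
  from this[of v] this[of "\<lambda>c. - v c"] show ?thesis by auto
qed

lemma metric_uminus:
  assumes p: "p \<in> points A" and T: "u \<in> tangent_space A p" "v \<in> tangent_space A p"
  shows "g p (\<lambda>c. - u c) v = - g p u v" and "g p u (\<lambda>c. - v c) = - g p u v"
proof -
  have *: "g p (\<lambda>c. - u c) v = - g p u v" if "u \<in> tangent_space A p" "v \<in> tangent_space A p" for u v
    using symmetric_bilinear_onD(2)[OF bilinear_metric[OF p] that(1,1,2), of "- 1" 0] by simp
  show "g p (\<lambda>c. - u c) v = - g p u v" by (rule *[OF T])
  have "g p u (\<lambda>c. - v c) = g p (\<lambda>c. - v c) u"
    using T tangent_space_uminus[OF p] by (intro metric_sym[OF p]) simp_all
  also have "\<dots> = - g p v u" by (rule *[OF T(2,1)])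
  also have "g p v u = g p u v" by (rule metric_sym[OF p T(2,1)])
  finally show "g p u (\<lambda>c. - v c) = - g p u v" .
qed

lemma timelike_uminus:
  assumes p: "p \<in> points A"
  shows "timelike_at A g p (\<lambda>c. - v c) \<longleftrightarrow> timelike_at A g p v"
proof (cases "v \<in> tangent_space A p")
  case True
  then show ?thesis
    using metric_uminus[OF p, of v "\<lambda>c. - v c"] metric_uminus[OF p True True] tangent_space_uminus[OF p]
    by (simp add: timelike_at_def)
qed (simp add: timelike_at_def tangent_space_uminus[OF p])

text \<open>
  If \<^term>\<open>u\<close> selects the future cone, its negative selects the reversed cone; a continuous field of
  future vectors becomes one of reversed vectors by changing the sign.
\<close>

lemma spacetime_reverse_cones: "spacetime A g (reverse_cones F)"
proof -
  have "\<exists>u. timelike_at A g p u \<and> reverse_cones F p = timecone A g p u" if p: "p \<in> points A" for p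
  proof -
    obtain u where u: "timelike_at A g p u" "F p = timecone A g p u" by (rule future_cone[OF p])
    have "v \<in> reverse_cones F p \<longleftrightarrow> v \<in> timecone A g p (\<lambda>c. - u c)" for v
    proof (cases "timelike_at A g p v")
      case True
      have "g p u (\<lambda>c. - v c) = g p (\<lambda>c. - u c) v"
        using metric_uminus[OF p, of u v] u(1) True by (simp add: timelike_at_def)
      then show ?thesis using u(2) by (simp add: reverse_cones_def timecone_def timelike_uminus[OF p])
    qed (simp add: reverse_cones_def u(2) timecone_def timelike_uminus[OF p])
    then have "reverse_cones F p = timecone A g p (\<lambda>c. - u c)" by blast
    then show ?thesis using u(1) timelike_uminus[OF p] by blast
  qed
  moreover have "\<exists>W V. open W \<and> p \<in> W \<and> W \<subseteq> points A \<and> continuous_vector_field_on A W V \<and>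
      (\<forall>q\<in>W. V q \<in> reverse_cones F q)" if p: "p \<in> points A" for p
  proof -
    obtain W V where W: "open W" "p \<in> W" "W \<subseteq> points A"
      and V: "continuous_vector_field_on A W V" "\<forall>q\<in>W. V q \<in> F q"
      using spacetime p unfolding spacetime_def time_orientation_def by blast
    have "continuous_vector_field_on A W (\<lambda>q c. - V q c)"
      unfolding continuous_vector_field_on_def
    proof (intro conjI ballI)
      show "(\<lambda>c. - V q c) \<in> tangent_space A q" if "q \<in> W" for q
        using V(1) W(3) that tangent_space_uminus unfolding continuous_vector_field_on_def by blast
      show "continuous_on (W \<inter> dom_chart c) (\<lambda>q. - V q c)" if "c \<in> A" for c
        using V(1) that unfolding continuous_vector_field_on_def by (intro continuous_on_minus) blast
    qed
    moreover have "\<forall>q\<in>W. (\<lambda>c. - V q c) \<in> reverse_cones F q" using V(2) by (simp add: reverse_cones_def)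
    ultimately show ?thesis using W by (intro exI[of _ W] exI[of _ "\<lambda>q c. - V q c"] conjI)
  qed
  ultimately show ?thesis
    using spacetime unfolding spacetime_def time_orientation_def by blast
qed

lemma reverse_future_timelike:
  assumes p: "p \<in> points A"
  shows "reverse_cones (future_timelike A g F) p \<subseteq> future_timelike A g (reverse_cones F) p"
  using timelike_uminus[OF p] by (auto simp: reverse_cones_def future_timelike_def)

lemma reverse_future_nonspacelike:
  assumes p: "p \<in> points A"
  shows "reverse_cones (future_nonspacelike A g F) p \<subseteq> future_nonspacelike A g (reverse_cones F) p"
proof
  fix v assume "v \<in> reverse_cones (future_nonspacelike A g F) p"
  then have v: "(\<lambda>c. - v c) \<in> tangent_space A p" "(\<lambda>c. - v c) \<noteq> (\<lambda>_. 0)"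
    "g p (\<lambda>c. - v c) (\<lambda>c. - v c) \<le> 0" "\<forall>u\<in>F p. g p u (\<lambda>c. - v c) < 0"
    by (simp_all add: reverse_cones_def future_nonspacelike_def nonspacelike_at_def)
  have vT: "v \<in> tangent_space A p" using v(1) tangent_space_uminus[OF p] by simp
  have "v \<noteq> (\<lambda>_. 0)" using v(2) by auto
  moreover have "g p v v \<le> 0"
    using v(3) metric_uminus(1)[OF p vT v(1)] metric_uminus(2)[OF p vT vT] by simp
  moreover have "g p u v < 0" if u: "u \<in> reverse_cones F p" for u
  proof -
    have uF: "(\<lambda>c. - u c) \<in> F p" using u by (simp add: reverse_cones_def)
    then have uT: "u \<in> tangent_space A p"
      using future_cone_timelike[OF p] tangent_space_uminus[OF p] unfolding timelike_at_def by blast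
    show ?thesis
      using v(4) uF metric_uminus(1)[OF p uT v(1)] metric_uminus(2)[OF p uT vT] by fastforce
  qed
  ultimately show "v \<in> future_nonspacelike A g (reverse_cones F) p"
    using vT by (simp add: future_nonspacelike_def nonspacelike_at_def)
qed

lemma chron_precedes_reverse:
  assumes "chron_precedes A g F p q"
  shows "chron_precedes A g (reverse_cones F) q p"
proof -
  obtain \<gamma> a b where \<gamma>: "piecewise_C1_curve_in A (future_timelike A g F) a b \<gamma>" "\<gamma> a = p" "\<gamma> b = q"
    using assms unfolding chron_precedes_def by (elim exE conjE) (rule that)
  have "piecewise_C1_curve_in A (future_timelike A g (reverse_cones F)) (- b) (- a) (\<gamma> \<circ> uminus)"
    by (rule piecewise_C1_curve_in_mono[OF piecewise_C1_curve_in_reverse[OF \<gamma>(1)] reverse_future_timelike])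
  moreover have "(\<gamma> \<circ> uminus) (- b) = q" "(\<gamma> \<circ> uminus) (- a) = p" using \<gamma>(2,3) by simp_all
  ultimately show ?thesis unfolding chron_precedes_def by (intro exI conjI)
qed

lemma causal_precedes_reverse:
  assumes "causal_precedes A g F p q"
  shows "causal_precedes A g (reverse_cones F) q p"
proof (cases "p = q")
  case True
  then show ?thesis by (simp add: causal_precedes_def)
next
  case False
  then have "\<exists>\<gamma> a b. piecewise_C1_curve_in A (future_nonspacelike A g F) a b \<gamma> \<and> \<gamma> a = p \<and> \<gamma> b = q"
    using assms unfolding causal_precedes_def by simp
  then obtain \<gamma> a b where \<gamma>: "piecewise_C1_curve_in A (future_nonspacelike A g F) a b \<gamma>"
    "\<gamma> a = p" "\<gamma> b = q"
    by (elim exE conjE) (rule that)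
  have "piecewise_C1_curve_in A (future_nonspacelike A g (reverse_cones F)) (- b) (- a) (\<gamma> \<circ> uminus)"
    by (rule piecewise_C1_curve_in_mono[OF piecewise_C1_curve_in_reverse[OF \<gamma>(1)] reverse_future_nonspacelike])
  moreover have "(\<gamma> \<circ> uminus) (- b) = q" "(\<gamma> \<circ> uminus) (- a) = p" using \<gamma>(2,3) by simp_all
  ultimately show ?thesis unfolding causal_precedes_def by (intro disjI2 exI conjI)
qed

lemma past_eq_reverse_future:
  shows "I_minus A g F S = I_plus A g (reverse_cones F) S"
    and "J_minus A g F S = J_plus A g (reverse_cones F) S"
proof -
  interpret reversed: lorentzian_spacetime A g "reverse_cones F"
    by unfold_locales (rule spacetime_reverse_cones)
  have "chron_precedes A g F p q \<longleftrightarrow> chron_precedes A g (reverse_cones F) q p" for p q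
    using chron_precedes_reverse[of p q] reversed.chron_precedes_reverse[of q p] by auto
  then show "I_minus A g F S = I_plus A g (reverse_cones F) S"
    by (simp add: I_minus_def I_plus_def I_minus_pt_def I_plus_pt_def)
  have "causal_precedes A g F p q \<longleftrightarrow> causal_precedes A g (reverse_cones F) q p" for p q
    using causal_precedes_reverse[of p q] reversed.causal_precedes_reverse[of q p] by auto
  then show "J_minus A g F S = J_plus A g (reverse_cones F) S"
    by (simp add: J_minus_def J_plus_def J_minus_pt_def J_plus_pt_def)
qed

end

theorem proposition25:
  fixes A :: "('a::{t2_space,second_countable_topology}, 'e::euclidean_space) chart set"
    and g :: "('a, 'e) metric"
    and F :: "'a \<Rightarrow> ('a, 'e) tvec set"
    and S :: "'a set"
  assumes "spacetime A g F"
    and "open S" and "S \<subseteq> points A"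
  shows "S \<subseteq> I_plus A g F S \<and> S \<subseteq> I_minus A g F S \<and>
         I_plus A g F S = J_plus A g F S \<and> I_minus A g F S = J_minus A g F S"
proof -
  interpret lorentzian_spacetime A g F by unfold_locales (rule assms(1))
  interpret reversed: lorentzian_spacetime A g "reverse_cones F"
    by unfold_locales (rule spacetime_reverse_cones)
  show ?thesis
    unfolding past_eq_reverse_future
    using open_subset_I_plus[OF assms(2,3)] reversed.open_subset_I_plus[OF assms(2,3)]
      J_plus_open_subset_I_plus[OF assms(2,3)] reversed.J_plus_open_subset_I_plus[OF assms(2,3)]
      I_plus_subset_J_plus[of S] reversed.I_plus_subset_J_plus[of S] by blast
qed

end
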